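(* Let $p,q\ge1$ be integers with $p\equiv q\pmod 2$. For every integer $m\ge0$, the $(\mathfrak g,K)$-modules $M^{+}(m)$ and $M^{-}(m)$ for $\mathrm O(p,q)$ (defined in the context) are isomorphic to each other.
   Context: Notation: $\mathbb N=\{0,1,2,\dots\}$. $G=\mathrm O(p,q)=\{g\in \mathrm{GL}_{p+q}(\mathbb R): {}^tg I_{p,q}g=I_{p,q}\}$ with $I_{p,q}=\mathrm{diag}(1_p,-1_q)$; $K\simeq \mathrm O(p)\times \mathrm O(q)$ is the block-diagonal maximal compact subgroup; $\mathfrak g=\mathfrak o(p,q)\otimes_{\mathbb R}\mathbb C$. With $E_{a,b}$ the matrix units, $\mathfrak g$ is spanned by $X^+_{i,j}=E_{i,j}-E_{j,i}$ ($1\le i,j\le p$), $X^+_{p+i,p+j}=E_{p+i,p+j}-E_{p+j,p+i}$ ($1\le i,j\le q$), and $X^-_{i,j}=E_{i,p+j}+E_{p+j,i}$ ($1\le i\le p$, $1\le j\le q$). Let $x=(x_1,\dots,x_p)$, $y=(y_1,\dots,y_q)$ be the coordinates on $V=\mathbb R^p\times\mathbb R^q$. $\mathfrak g$ acts by the linear map $\pi$ into polynomial-coefficient differential operators on $V$: $\pi(X^+_{i,j})=-x_j\partial_{x_i}+x_i\partial_{x_j}$, $\pi(X^+_{p+i,p+j})=-y_j\partial_{y_i}+y_i\partial_{y_j}$, $\pi(X^-_{i,j})=\sqrt{-1}\,(x_iy_j+\partial_{x_i}\partial_{y_j})$; this is a Lie algebra homomorphism. $K$ acts on functions on $V$ by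 $(a,d)\cdot f(x,y)=f(a^{-1}x,d^{-1}y)$. Put $E_x=\sum x_i\partial_{x_i}$, $r_x^2=\sum x_i^2$, $\Delta_x=\sum\partial_{x_i}^2$, $E_y=\sum y_j\partial_{y_j}$, $r_y^2=\sum y_j^2$, $\Delta_y=\sum\partial_{y_j}^2$, $\rho_x=r_x^2/2$, $\rho_y=r_y^2/2$, and $H=-E_x-\frac p2+E_y+\frac q2$, $X^+=-\frac12(\Delta_x+r_y^2)$, $X^-=\frac12(r_x^2+\Delta_y)$. These satisfy $[H,X^\pm]=\pm2X^\pm$, $[X^+,X^-]=H$ and commute with $\pi(\mathfrak g)$. $\mathcal H^k(\mathbb R^n)$ is the space of homogeneous harmonic polynomials of degree $k$ on $\mathbb R^n$. For $\alpha\in\mathbb C\setminus(-\mathbb N)$ let $\Psi_\alpha(u)=\sum_{n\ge0}\frac{(-1)^n}{n!\,(\alpha)_n}u^n$ with $(\alpha)_n=\alpha(\alpha+1)\cdots(\alpha+n-1)$, and $\psi_\alpha=\Psi_\alpha(r_x^2r_y^2/4)=\Psi_\alpha(\rho_x\rho_y)$. Let $\mathcal E$ be the complex linear span of all functions $h_1(x)h_2(y)\rho_x^a\rho_y^b\psi_\alpha$ with $h_1\in\mathcal H^k(\mathbb R^p)$, $h_2\in\mathcal H^l(\mathbb R^q)$, $k,l,a,b\in\mathbb N$, $\alpha\in\mathbb C\setminus(-\mathbb N)$. $\mathcal E$ is stable under $\mathfrak g$, $K$ and $H,X^\pm$. For $m\in\mathbb N$, $M^{+}(m)$ consists of $0$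 and all $f\in\mathcal E$ with $Hf=mf$, $X^+f=0$, $(X^-)^jf\ne0$ for $1\le j\le m$, and $(X^-)^{m+1}f=0$; $M^{-}(m)$ consists of $0$ and all $f\in\mathcal E$ with $Hf=-mf$, $X^-f=0$, $(X^+)^jf\neq0$ for $1\le j\le m$, and $(X^+)^{m+1}f=0$. They carry the restricted actions of $\mathfrak g$ (via $\pi$) and $K$. *)

theory Defs
  imports "HOL-Analysis.Analysis" "HOL-Library.Function_Algebras" "HOL-Library.Nonpos_Ints"
begin

text \<open>
  The dimensions are \<open>p = CARD('p)\<close> and \<open>q = CARD('q)\<close>, so \<open>p, q \<ge> 1\<close> is automatic.
  Matrices of size \<open>p + q\<close> are indexed by \<open>'p + 'q\<close>: \<open>Inl i\<close> is the index \<open>i\<close> and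
  \<open>Inr j\<close> is the index \<open>p + j\<close>.
\<close>

type_synonym ('p, 'q) vfun = "(real^'p) \<times> (real^'q) \<Rightarrow> complex"

definition cscale :: "complex \<Rightarrow> ('a \<Rightarrow> complex) \<Rightarrow> 'a \<Rightarrow> complex" where
  "cscale c f = (\<lambda>z. c * f z)"

global_interpretation cfun: vector_space "cscale :: complex \<Rightarrow> ('a \<Rightarrow> complex) \<Rightarrow> 'a \<Rightarrow> complex"
  by unfold_locales (auto simp: cscale_def fun_eq_iff algebra_simps)


section \<open>Differential operators\<close>

text \<open>
  Directional derivatives are total functions in HOL; they are only used on smooth functions,
  namely on polynomials and on the elements of the space \<open>Espace\<close> below.
\<close>

definition dird :: "'a::real_normed_vector \<Rightarrow> ('a \<Rightarrow> complex) \<Rightarrow> 'a \<Rightarrow> complex" where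
  "dird v f = (\<lambda>z. vector_derivative (\<lambda>t. f (z + t *\<^sub>R v)) (at 0))"

definition dx :: "'p::finite \<Rightarrow> ('p, 'q::finite) vfun \<Rightarrow> ('p, 'q) vfun" where
  "dx i = dird (axis i 1, 0)"

definition dy :: "'q::finite \<Rightarrow> ('p::finite, 'q) vfun \<Rightarrow> ('p, 'q) vfun" where
  "dy j = dird (0, axis j 1)"

definition cx :: "'p::finite \<Rightarrow> ('p, 'q::finite) vfun" where
  "cx i = (\<lambda>(x, y). complex_of_real (x $ i))"

definition cy :: "'q::finite \<Rightarrow> ('p::finite, 'q) vfun" where
  "cy j = (\<lambda>(x, y). complex_of_real (y $ j))"

definition Ex :: "('p::finite, 'q::finite) vfun \<Rightarrow> ('p, 'q) vfun" where
  "Ex f = (\<lambda>z. \<Sum>i\<in>UNIV. cx i z * dx i f z)"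

definition Ey :: "('p::finite, 'q::finite) vfun \<Rightarrow> ('p, 'q) vfun" where
  "Ey f = (\<lambda>z. \<Sum>j\<in>UNIV. cy j z * dy j f z)"

definition Lapx :: "('p::finite, 'q::finite) vfun \<Rightarrow> ('p, 'q) vfun" where
  "Lapx f = (\<lambda>z. \<Sum>i\<in>UNIV. dx i (dx i f) z)"

definition Lapy :: "('p::finite, 'q::finite) vfun \<Rightarrow> ('p, 'q) vfun" where
  "Lapy f = (\<lambda>z. \<Sum>j\<in>UNIV. dy j (dy j f) z)"

definition r2x :: "('p::finite, 'q::finite) vfun" where
  "r2x = (\<lambda>z. \<Sum>i\<in>UNIV. (cx i z)\<^sup>2)"

definition r2y :: "('p::finite, 'q::finite) vfun" where
  "r2y = (\<lambda>z. \<Sum>j\<in>UNIV. (cy j z)\<^sup>2)"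

definition rhox :: "('p::finite, 'q::finite) vfun" where
  "rhox = (\<lambda>z. r2x z / 2)"

definition rhoy :: "('p::finite, 'q::finite) vfun" where
  "rhoy = (\<lambda>z. r2y z / 2)"

definition opH :: "('p::finite, 'q::finite) vfun \<Rightarrow> ('p, 'q) vfun" where
  "opH f = (\<lambda>z. - Ex f z - of_nat CARD('p) / 2 * f z + Ey f z + of_nat CARD('q) / 2 * f z)"

definition opXplus :: "('p::finite, 'q::finite) vfun \<Rightarrow> ('p, 'q) vfun" where
  "opXplus f = (\<lambda>z. - (1 / 2) * (Lapx f z + r2y z * f z))"

definition opXminus :: "('p::finite, 'q::finite) vfun \<Rightarrow> ('p, 'q) vfun" where
  "opXminus f = (\<lambda>z. 1 / 2 * (r2x z * f z + Lapy f z))"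


section \<open>The actions of the Lie algebra and of the compact group\<close>

definition Ipq :: "complex^('p::finite + 'q::finite)^('p + 'q)" where
  "Ipq = (\<chi> a b. if a = b then (case a of Inl _ \<Rightarrow> 1 | Inr _ \<Rightarrow> - 1) else 0)"

text \<open>The complexification of \<open>\<oo>(p,q)\<close>: complex matrices subject to the linear
  equations that define \<open>\<oo>(p,q)\<close> over the reals.\<close>

definition lie_opq :: "(complex^('p::finite + 'q::finite)^('p + 'q)) set" where
  "lie_opq = {X. transpose X ** Ipq + Ipq ** X = 0}"

definition Eunit :: "'n::finite \<Rightarrow> 'n \<Rightarrow> complex^'n^'n" where
  "Eunit a b = (\<chi> c d. if c = a \<and> d = b then 1 else 0)"

definition genP :: "'p::finite \<Rightarrow> 'p \<Rightarrow> complex^('p + 'q::finite)^('p + 'q)" where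
  "genP i j = Eunit (Inl i) (Inl j) - Eunit (Inl j) (Inl i)"

definition genQ :: "'q::finite \<Rightarrow> 'q \<Rightarrow> complex^('p::finite + 'q)^('p + 'q)" where
  "genQ i j = Eunit (Inr i) (Inr j) - Eunit (Inr j) (Inr i)"

definition genM :: "'p::finite \<Rightarrow> 'q::finite \<Rightarrow> complex^('p + 'q)^('p + 'q)" where
  "genM i j = Eunit (Inl i) (Inr j) + Eunit (Inr j) (Inl i)"

definition piP :: "'p::finite \<Rightarrow> 'p \<Rightarrow> ('p, 'q::finite) vfun \<Rightarrow> ('p, 'q) vfun" where
  "piP i j f = (\<lambda>z. - cx j z * dx i f z + cx i z * dx j f z)"

definition piQ :: "'q::finite \<Rightarrow> 'q \<Rightarrow> ('p::finite, 'q) vfun \<Rightarrow> ('p, 'q) vfun" where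
  "piQ i j f = (\<lambda>z. - cy j z * dy i f z + cy i z * dy j f z)"

definition piM :: "'p::finite \<Rightarrow> 'q::finite \<Rightarrow> ('p, 'q) vfun \<Rightarrow> ('p, 'q) vfun" where
  "piM i j f = (\<lambda>z. \<i> * (cx i z * cy j z * f z + dx i (dy j f) z))"

text \<open>The linear extension of \<open>genP i j \<mapsto> piP i j\<close>, \<open>genQ i j \<mapsto> piQ i j\<close>,
  \<open>genM i j \<mapsto> piM i j\<close>. Each pair \<open>i \<noteq> j\<close> occurs twice in the first two sums, whence the
  factors 1/2; see \<open>lie_opq_expand\<close> and \<open>pi_act_gen\<close> below.\<close>

definition pi_act :: "complex^('p::finite + 'q::finite)^('p + 'q) \<Rightarrow> ('p, 'q) vfun \<Rightarrow> ('p, 'q) vfun" where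
  "pi_act X f = (\<lambda>z.
      (\<Sum>i\<in>UNIV. \<Sum>j\<in>UNIV. X $ Inl i $ Inl j * piP i j f z) / 2
    + (\<Sum>i\<in>UNIV. \<Sum>j\<in>UNIV. X $ Inr i $ Inr j * piQ i j f z) / 2
    + (\<Sum>i\<in>UNIV. \<Sum>j\<in>UNIV. X $ Inl i $ Inr j * piM i j f z))"

definition Kgrp :: "((real^'p::finite^'p) \<times> (real^'q::finite^'q)) set" where
  "Kgrp = {(a, d). orthogonal_matrix a \<and> orthogonal_matrix d}"

definition K_act :: "(real^'p::finite^'p) \<times> (real^'q::finite^'q) \<Rightarrow> ('p, 'q) vfun \<Rightarrow> ('p, 'q) vfun" where
  "K_act k f = (\<lambda>(x, y). f (matrix_inv (fst k) *v x, matrix_inv (snd k) *v y))"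

lemma lie_opq_iff:
  fixes X :: "complex^('p::finite + 'q::finite)^('p + 'q)"
  shows "X \<in> lie_opq \<longleftrightarrow>
       (\<forall>i j. X $ Inl i $ Inl j = - X $ Inl j $ Inl i)
     \<and> (\<forall>k l. X $ Inr k $ Inr l = - X $ Inr l $ Inr k)
     \<and> (\<forall>i k. X $ Inr k $ Inl i = X $ Inl i $ Inr k)"
proof -
  have comp: "(transpose X ** Ipq + Ipq ** X) $ a $ b =
      X $ b $ a * (case b of Inl _ \<Rightarrow> 1 | Inr _ \<Rightarrow> - 1)
      + (case a of Inl _ \<Rightarrow> 1 | Inr _ \<Rightarrow> - 1) * X $ a $ b" for a b
    by (simp add: matrix_matrix_mult_def transpose_def Ipq_def
        if_distrib if_distribR cong: if_cong)
  have "X \<in> lie_opq \<longleftrightarrow> (\<forall>a b. X $ b $ a * (case b of Inl _ \<Rightarrow> 1 | Inr _ \<Rightarrow> - 1)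
      + (case a of Inl _ \<Rightarrow> 1 | Inr _ \<Rightarrow> - 1) * X $ a $ b = 0)"
    unfolding lie_opq_def mem_Collect_eq
    by (subst vec_eq_iff, subst vec_eq_iff) (simp only: comp zero_index)
  note lie = this
  have signs: "u * 1 + 1 * v = 0 \<longleftrightarrow> v = - u" "u * - 1 + - 1 * v = 0 \<longleftrightarrow> v = - u"
    "u * 1 + - 1 * v = 0 \<longleftrightarrow> u = v" "u * - 1 + 1 * v = 0 \<longleftrightarrow> u = v" for u v :: complex
    by algebra+
  have aux: "((\<forall>i. (\<forall>j. P i j) \<and> (\<forall>k. Q i k)) \<and> (\<forall>k. (\<forall>i. R k i) \<and> (\<forall>l. S k l)))
      \<longleftrightarrow> (\<forall>i j. P i j) \<and> (\<forall>k l. S k l) \<and> (\<forall>i k. Q i k)"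
    if "\<And>i k. R k i \<longleftrightarrow> Q i k"
    for P :: "'p \<Rightarrow> 'p \<Rightarrow> bool" and Q :: "'p \<Rightarrow> 'q \<Rightarrow> bool" and R S
    using that by blast
  show ?thesis
    unfolding lie split_sum_all sum.case signs by (rule aux, rule eq_commute)
qed

lemma dsum_delta:
  fixes F :: "'a::finite \<Rightarrow> 'b::finite \<Rightarrow> complex"
  shows "(\<Sum>i\<in>UNIV. \<Sum>j\<in>UNIV. F i j * (if a = i \<and> b = j then 1 else 0)) = F a b"
    and "(\<Sum>i\<in>UNIV. \<Sum>j\<in>UNIV. F i j * (if b = j \<and> a = i then 1 else 0)) = F a b"
    and "(\<Sum>i\<in>UNIV. \<Sum>j\<in>UNIV. (if i = a \<and> j = b then 1 else 0) * F i j) = F a b"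
proof -
  have *: "(\<Sum>i\<in>UNIV. \<Sum>j\<in>UNIV. if a = i \<and> b = j then F i j else 0) = F a b"
    by (subst sum.cong[OF refl, where h = "\<lambda>i. if a = i then F i b else 0"]) auto
  show "(\<Sum>i\<in>UNIV. \<Sum>j\<in>UNIV. F i j * (if a = i \<and> b = j then 1 else 0)) = F a b"
    by (subst *[symmetric], intro sum.cong) auto
  show "(\<Sum>i\<in>UNIV. \<Sum>j\<in>UNIV. F i j * (if b = j \<and> a = i then 1 else 0)) = F a b"
    by (subst *[symmetric], intro sum.cong) auto
  show "(\<Sum>i\<in>UNIV. \<Sum>j\<in>UNIV. (if i = a \<and> j = b then 1 else 0) * F i j) = F a b"
    by (subst *[symmetric], intro sum.cong) auto
qed

lemma gen_in_lie_opq: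
  "genP i j \<in> (lie_opq :: (complex^('p::finite + 'q::finite)^('p + 'q)) set)"
  "genQ k l \<in> (lie_opq :: (complex^('p::finite + 'q::finite)^('p + 'q)) set)"
  "genM i k \<in> (lie_opq :: (complex^('p::finite + 'q::finite)^('p + 'q)) set)"
  unfolding lie_opq_iff genP_def genQ_def genM_def Eunit_def
    vector_minus_component vector_add_component vec_lambda_beta
  by (simp_all only: minus_diff_eq sum.inject sum.distinct conj_commute simp_thms if_False
      diff_0_right add_0_left add_0_right neg_equal_zero minus_zero)

lemma lie_opq_expand:
  fixes X :: "complex^('p::finite + 'q::finite)^('p + 'q)"
  assumes "X \<in> lie_opq"
  shows "X $ a $ b = (\<Sum>i\<in>UNIV. \<Sum>j\<in>UNIV. X $ Inl i $ Inl j / 2 * genP i j $ a $ b)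
           + (\<Sum>i\<in>UNIV. \<Sum>j\<in>UNIV. X $ Inr i $ Inr j / 2 * genQ i j $ a $ b)
           + (\<Sum>i\<in>UNIV. \<Sum>j\<in>UNIV. X $ Inl i $ Inr j * genM i j $ a $ b)"
proof -
  have PP: "X $ Inl i $ Inl j = - X $ Inl j $ Inl i" for i j
    using assms unfolding lie_opq_iff by blast
  have QQ: "X $ Inr i $ Inr j = - X $ Inr j $ Inr i" for i j
    using assms unfolding lie_opq_iff by blast
  have PQ: "X $ Inr j $ Inl i = X $ Inl i $ Inr j" for i j
    using assms unfolding lie_opq_iff by blast
  have half: "X $ Inl i $ Inl j = X $ Inl i $ Inl j / 2 - X $ Inl j $ Inl i / 2"
    "X $ Inr k $ Inr l = X $ Inr k $ Inr l / 2 - X $ Inr l $ Inr k / 2" for i j k l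
    by (subst PP[of j i] QQ[of l k], simp)+
  show ?thesis
    by (cases a; cases b)
      (auto simp: genP_def genQ_def genM_def Eunit_def dsum_delta right_diff_distrib
         sum_subtractf PQ simp flip: sum_divide_distrib intro: half)
qed

lemma pi_act_gen:
  "pi_act (genP i j) = (piP i j :: ('p::finite, 'q::finite) vfun \<Rightarrow> _)"
  "pi_act (genQ k l) = (piQ k l :: ('p::finite, 'q::finite) vfun \<Rightarrow> _)"
  "pi_act (genM i k) = (piM i k :: ('p::finite, 'q::finite) vfun \<Rightarrow> _)"
  by (auto simp: fun_eq_iff pi_act_def genP_def genQ_def genM_def Eunit_def dsum_delta
      left_diff_distrib sum_subtractf piP_def piQ_def)


section \<open>The function space and the modules\<close>

text \<open>The second condition says that the polynomial \<open>h\<close> is homogeneous of degree \<open>k\<close>.\<close>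

definition harm :: "nat \<Rightarrow> (real^'n::finite \<Rightarrow> complex) set" where
  "harm k = {h. polynomial_function h
              \<and> (\<forall>t x. h (t *\<^sub>R x) = complex_of_real t ^ k * h x)
              \<and> (\<forall>x. (\<Sum>i\<in>UNIV. dird (axis i 1) (dird (axis i 1) h) x) = 0)}"

definition Psi :: "complex \<Rightarrow> complex \<Rightarrow> complex" where
  "Psi \<alpha> u = (\<Sum>n. (- 1) ^ n / (fact n * pochhammer \<alpha> n) * u ^ n)"

definition psi :: "complex \<Rightarrow> ('p::finite, 'q::finite) vfun" where
  "psi \<alpha> = (\<lambda>z. Psi \<alpha> (rhox z * rhoy z))"

definition Espace :: "('p::finite, 'q::finite) vfun set" where
  "Espace = cfun.span
     {\<lambda>z. h1 (fst z) * h2 (snd z) * rhox z ^ a * rhoy z ^ b * psi \<alpha> z | h1 h2 k l a b \<alpha>.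
        h1 \<in> harm k \<and> h2 \<in> harm l \<and> \<alpha> \<notin> \<int>\<^sub>\<le>\<^sub>0}"

definition Mplus :: "nat \<Rightarrow> ('p::finite, 'q::finite) vfun set" where
  "Mplus m = {f. f = 0 \<or>
     (f \<in> Espace \<and> opH f = cscale (of_nat m) f \<and> opXplus f = 0
      \<and> (\<forall>j. 1 \<le> j \<and> j \<le> m \<longrightarrow> (opXminus ^^ j) f \<noteq> 0) \<and> (opXminus ^^ (m + 1)) f = 0)}"

definition Mminus :: "nat \<Rightarrow> ('p::finite, 'q::finite) vfun set" where
  "Mminus m = {f. f = 0 \<or>
     (f \<in> Espace \<and> opH f = cscale (- of_nat m) f \<and> opXminus f = 0
      \<and> (\<forall>j. 1 \<le> j \<and> j \<le> m \<longrightarrow> (opXplus ^^ j) f \<noteq> 0) \<and> (opXplus ^^ (m + 1)) f = 0)}"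

text \<open>All modules considered are subspaces of \<open>Espace\<close> with the restrictions of the ambient
  actions \<open>pi_act\<close> and \<open>K_act\<close>. The compatibility axioms of a \<open>(\<gg>, K)\<close>-module are
  inherited from \<open>Espace\<close>; what depends on the subspace is its stability.\<close>

definition gK_submodule :: "('p::finite, 'q::finite) vfun set \<Rightarrow> bool" where
  "gK_submodule M \<longleftrightarrow> cfun.subspace M \<and> M \<subseteq> Espace
     \<and> (\<forall>X\<in>lie_opq. \<forall>f\<in>M. pi_act X f \<in> M)
     \<and> (\<forall>k\<in>Kgrp. \<forall>f\<in>M. K_act k f \<in> M)"

definition gK_isomorphism ::
  "(('p::finite, 'q::finite) vfun \<Rightarrow> ('p, 'q) vfun) \<Rightarrow> ('p, 'q) vfun set \<Rightarrow> ('p, 'q) vfun set \<Rightarrow> bool" where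
  "gK_isomorphism T M N \<longleftrightarrow> bij_betw T M N
     \<and> (\<forall>f\<in>M. \<forall>g\<in>M. T (f + g) = T f + T g)
     \<and> (\<forall>c. \<forall>f\<in>M. T (cscale c f) = cscale c (T f))
     \<and> (\<forall>X\<in>lie_opq. \<forall>f\<in>M. T (pi_act X f) = pi_act X (T f))
     \<and> (\<forall>k\<in>Kgrp. \<forall>f\<in>M. T (K_act k f) = K_act k (T f))"

definition gK_isomorphic :: "('p::finite, 'q::finite) vfun set \<Rightarrow> ('p, 'q) vfun set \<Rightarrow> bool" where
  "gK_isomorphic M N \<longleftrightarrow> gK_submodule M \<and> gK_submodule N \<and> (\<exists>T. gK_isomorphism T M N)"

end

theory Submission
  imports Defs
begin

text \<open>
  The triple \<open>opXplus\<close>, \<open>opXminus\<close>, \<open>opH\<close> satisfies the relations of \<open>sl\<^sub>2\<close> on \<open>Espace\<close> and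
  commutes with \<open>pi_act\<close> and \<open>K_act\<close>. By \<open>sl\<^sub>2\<close> theory a nonzero \<open>f\<close> with \<open>opH f = m f\<close> and
  \<open>opXplus f = 0\<close> satisfies \<open>opXplus\<^sup>j (opXminus\<^sup>j f) = c f\<close> with \<open>c \<noteq> 0\<close> for \<open>j \<le> m\<close>. Hence the
  nonvanishing conditions in the definition of \<open>Mplus m\<close> are automatic, \<open>Mplus m\<close> is a subspace, and
  \<open>opXminus\<^sup>m\<close> is a bijection from \<open>Mplus m\<close> onto \<open>Mminus m\<close>, with inverse a multiple of
  \<open>opXplus\<^sup>m\<close>. It commutes with the two actions, so it is an isomorphism of modules. This part is
  the locale \<open>sl2_action\<close>, in particular \<open>bij_betw_Fpow\<close>.

  The analytic content is that all these operators act on \<open>Espace\<close> and satisfy the expected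
  commutation relations there. The relations follow from the Leibniz rule
  \<open>\<partial>\<^sub>b (x\<^sub>c f) = x\<^sub>c \<partial>\<^sub>b f + \<delta>\<^sub>b\<^sub>c f\<close> and the symmetry of second derivatives on any space of
  differentiable functions that is stable under the coordinates and the partial derivatives; such a
  space is called a \<open>diff_module\<close>. That \<open>Espace\<close> is one (\<open>Espace_eq\<close>, \<open>diff_module_Psi\<close>) rests on
  two facts. Firstly, the derivative of \<open>Psi \<alpha>\<close> is \<open>- 1 / \<alpha>\<close> times \<open>Psi (\<alpha> + 1)\<close>, so that the
  functions \<open>P \<cdot> psi \<alpha>\<close> with \<open>P\<close> a polynomial span a space stable under differentiation. Secondly,
  this span is \<open>Espace\<close>, because of the Fischer decomposition: every polynomial on \<open>\<real>\<^sup>n\<close> is a linear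
  combination of products \<open>r\<^sup>2\<^sup>a h\<close> with \<open>h\<close> homogeneous and harmonic (\<open>polys_span_fischer_gens\<close>).
\<close>

section \<open>Directional derivatives and coordinates\<close>

text \<open>
  Identities between operators are proved at the level of functions, with the pointwise ring
  structure. The rules \<open>(f + g) x = f x + g x\<close> etc. would destroy that level whenever a function
  is eta-expanded, so they are only used on demand.
\<close>

lemmas fun_apply = plus_fun_apply zero_fun_apply times_fun_apply one_fun_apply
  numeral_fun_apply of_nat_fun_apply minus_apply uminus_apply
declare fun_apply [simp del]

lemma fun_sum_apply: "(\<Sum>i\<in>I. F i) z = (\<Sum>i\<in>I. F i z)"
  for F :: "'i \<Rightarrow> 'a \<Rightarrow> complex"
  by (induction I rule: infinite_finite_induct) (simp_all add: fun_apply)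

text \<open>
  The coordinates of a Euclidean space are indexed by its basis vectors, so that a set of
  coordinates, for example those of the first factor of \<open>\<real>\<^sup>p \<times> \<real>\<^sup>q\<close>, is a subset of \<open>Basis\<close>.
\<close>

definition coord :: "'a::euclidean_space \<Rightarrow> 'a \<Rightarrow> complex" where
  "coord b = (\<lambda>z. complex_of_real (z \<bullet> b))"

lemma cscale_mult_left: "cscale c f * g = cscale c (f * g)"
  and cscale_mult_right: "f * cscale c g = cscale c (f * g)"
  by (auto simp: cscale_def fun_eq_iff fun_apply)

lemma dird_eq:
  assumes "(f has_derivative f') (at z)"
  shows "dird v f z = f' v"
proof -
  have 1: "((\<lambda>t. z + t *\<^sub>R v) has_derivative (\<lambda>t. t *\<^sub>R v)) (at 0)"
    by (auto intro!: derivative_eq_intros)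
  have "((\<lambda>t. f (z + t *\<^sub>R v)) has_derivative (\<lambda>t. f' (t *\<^sub>R v))) (at (0::real))"
    by (rule has_derivative_compose[OF 1]) (use assms in simp)
  moreover have "f' (t *\<^sub>R v) = t *\<^sub>R f' v" for t
    using assms has_derivative_bounded_linear linear_simps(5) by blast
  ultimately have "((\<lambda>t. f (z + t *\<^sub>R v)) has_vector_derivative f' v) (at 0)"
    by (simp add: has_vector_derivative_def)
  then show ?thesis
    unfolding dird_def by (rule vector_derivative_at)
qed

lemma dird_frechet:
  assumes "f differentiable (at z)"
  shows "dird v f z = frechet_derivative f (at z) v"
  using assms frechet_derivative_works dird_eq by blast

lemma dird_add:
  assumes "\<And>z. f differentiable (at z)" "\<And>z. g differentiable (at z)"
  shows "dird v (f + g) = dird v f + dird v g"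
proof
  fix z
  have "((\<lambda>z. f z + g z) has_derivative
     (\<lambda>v. frechet_derivative f (at z) v + frechet_derivative g (at z) v)) (at z)"
    using assms frechet_derivative_works by (blast intro: has_derivative_add)
  then show "dird v (f + g) z = (dird v f + dird v g) z"
    by (simp add: plus_fun_def dird_eq dird_frechet assms)
qed

lemma dird_mult:
  assumes "\<And>z. f differentiable (at z)" "\<And>z. g differentiable (at z)"
  shows "dird v (f * g) = dird v f * g + f * dird v g"
proof
  fix z
  have "((\<lambda>z. f z * g z) has_derivative
     (\<lambda>v. f z * frechet_derivative g (at z) v + frechet_derivative f (at z) v * g z)) (at z)"
    using assms frechet_derivative_works by (blast intro: has_derivative_mult)
  then show "dird v (f * g) z = (dird v f * g + f * dird v g) z"
    by (simp add: plus_fun_def times_fun_def dird_eq dird_frechet assms)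
qed

lemma coord_has_derivative: "(coord b has_derivative coord b) (at z)"
  unfolding coord_def by (auto intro!: derivative_eq_intros)

lemma coord_differentiable: "coord b differentiable (at z)"
  using coord_has_derivative differentiable_def by blast

lemma dird_coord: "dird v (coord b) = (\<lambda>z. coord b v)"
  by (rule ext) (rule dird_eq, rule coord_has_derivative)

lemma dird_const: "dird v (\<lambda>z. c) = 0"
  by (auto simp: fun_eq_iff fun_apply intro!: dird_eq)

lemma dird_cscale:
  assumes "\<And>z. f differentiable (at z)"
  shows "dird v (cscale c f) = cscale c (dird v f)"
  using dird_mult[of "\<lambda>z. c" f v] assms
  by (simp add: dird_const cscale_def times_fun_def plus_fun_def zero_fun_def)

lemma dird_coord_mult:
  assumes "\<And>z. f differentiable (at z)" "b \<in> Basis" "c \<in> Basis"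
  shows "dird b (coord c * f) = coord c * dird b f + (if b = c then f else 0)"
  using assms
  by (simp add: dird_mult coord_differentiable dird_coord)
    (auto simp: fun_eq_iff fun_apply coord_def inner_Basis)


section \<open>Modules over the Weyl algebra\<close>

text \<open>
  The Laplacian, the Euler operator and the squared radius in the coordinates from a set \<open>A\<close> of
  basis vectors.
\<close>

definition Lap :: "'a::euclidean_space set \<Rightarrow> ('a \<Rightarrow> complex) \<Rightarrow> 'a \<Rightarrow> complex" where
  "Lap A f = (\<Sum>b\<in>A. dird b (dird b f))"

definition Eul :: "'a::euclidean_space set \<Rightarrow> ('a \<Rightarrow> complex) \<Rightarrow> 'a \<Rightarrow> complex" where
  "Eul A f = (\<Sum>b\<in>A. coord b * dird b f)"

definition rsq :: "'a::euclidean_space set \<Rightarrow> 'a \<Rightarrow> complex" where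
  "rsq A = (\<Sum>b\<in>A. coord b * coord b)"

text \<open>
  A space of differentiable functions on which the coordinates and the partial derivatives act
  and satisfy the relations of the Weyl algebra. Its elements are smooth, since their partial
  derivatives of all orders are differentiable.
\<close>

locale diff_module =
  fixes S :: "('a::euclidean_space \<Rightarrow> complex) set"
  assumes smooth: "f \<in> S \<Longrightarrow> f differentiable (at z)"
    and subspace: "cfun.subspace S"
    and coord_closed: "b \<in> Basis \<Longrightarrow> f \<in> S \<Longrightarrow> coord b * f \<in> S"
    and dird_closed: "b \<in> Basis \<Longrightarrow> f \<in> S \<Longrightarrow> dird b f \<in> S"
    and dird_commute: "b \<in> Basis \<Longrightarrow> c \<in> Basis \<Longrightarrow> f \<in> S \<Longrightarrow>
      dird b (dird c f) = dird c (dird b f)"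
begin

lemmas add_closed = cfun.subspace_add[OF subspace]
lemmas zero_closed = cfun.subspace_0[OF subspace]
lemmas scale_closed = cfun.subspace_scale[OF subspace]
lemmas diff_closed = cfun.subspace_diff[OF subspace]
lemmas neg_closed = cfun.subspace_neg[OF subspace]
lemmas sum_closed = cfun.subspace_sum[OF subspace]

lemma two_closed: "f \<in> S \<Longrightarrow> 2 * f \<in> S"
  using add_closed[of f f] by (simp only: mult_2)

lemma if_closed: "f \<in> S \<Longrightarrow> (if P then f else 0) \<in> S"
  by (simp add: zero_closed)

lemma Lap_closed: "A \<subseteq> Basis \<Longrightarrow> f \<in> S \<Longrightarrow> Lap A f \<in> S"
  unfolding Lap_def by (rule sum_closed) (simp add: dird_closed subset_iff)

lemma Eul_closed: "A \<subseteq> Basis \<Longrightarrow> f \<in> S \<Longrightarrow> Eul A f \<in> S"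
  unfolding Eul_def by (rule sum_closed) (simp add: dird_closed coord_closed subset_iff)

lemma rsq_closed: "A \<subseteq> Basis \<Longrightarrow> f \<in> S \<Longrightarrow> rsq A * f \<in> S"
  unfolding rsq_def sum_distrib_right mult.assoc
  by (rule sum_closed) (simp add: coord_closed subset_iff)

lemmas closed = zero_closed add_closed scale_closed diff_closed neg_closed coord_closed dird_closed
  two_closed if_closed Lap_closed Eul_closed rsq_closed

lemma d_add: "f \<in> S \<Longrightarrow> g \<in> S \<Longrightarrow> dird b (f + g) = dird b f + dird b g"
  by (simp add: dird_add smooth)

lemma d_scale: "f \<in> S \<Longrightarrow> dird b (cscale c f) = cscale c (dird b f)"
  by (simp add: dird_cscale smooth)

lemma d_zero: "dird b (0 :: 'a \<Rightarrow> complex) = 0"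
  using dird_const[of b 0] by (simp add: zero_fun_def)

lemma d_two: "f \<in> S \<Longrightarrow> dird b (2 * f) = 2 * dird b f"
  by (simp only: mult_2 d_add)

lemma d_diff: "f \<in> S \<Longrightarrow> g \<in> S \<Longrightarrow> dird b (f - g) = dird b f - dird b g"
  by (metis (no_types) add_diff_cancel d_add diff_add_cancel diff_closed)

lemma d_sum:
  "finite I \<Longrightarrow> (\<And>i. i \<in> I \<Longrightarrow> F i \<in> S) \<Longrightarrow> dird b (\<Sum>i\<in>I. F i) = (\<Sum>i\<in>I. dird b (F i))"
  by (induction I rule: finite_induct) (simp_all add: d_zero d_add sum_closed)

lemma d_coord:
  "f \<in> S \<Longrightarrow> b \<in> Basis \<Longrightarrow> c \<in> Basis \<Longrightarrow>
    dird b (coord c * f) = coord c * dird b f + (if b = c then f else 0)"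
  by (simp add: dird_coord_mult smooth)

lemma Lap_add: "A \<subseteq> Basis \<Longrightarrow> f \<in> S \<Longrightarrow> g \<in> S \<Longrightarrow> Lap A (f + g) = Lap A f + Lap A g"
  unfolding Lap_def by (simp add: d_add dird_closed subset_iff sum.distrib cong: sum.cong)

lemma Lap_scale: "A \<subseteq> Basis \<Longrightarrow> f \<in> S \<Longrightarrow> Lap A (cscale c f) = cscale c (Lap A f)"
  unfolding Lap_def
  by (simp add: d_scale dird_closed subset_iff cfun.scale_sum_right cong: sum.cong)

lemma Lap_diff: "A \<subseteq> Basis \<Longrightarrow> f \<in> S \<Longrightarrow> g \<in> S \<Longrightarrow> Lap A (f - g) = Lap A f - Lap A g"
  unfolding Lap_def by (simp add: d_diff dird_closed subset_iff sum_subtractf cong: sum.cong)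

lemma Eul_add: "A \<subseteq> Basis \<Longrightarrow> f \<in> S \<Longrightarrow> g \<in> S \<Longrightarrow> Eul A (f + g) = Eul A f + Eul A g"
  unfolding Eul_def by (simp add: d_add subset_iff sum.distrib distrib_left cong: sum.cong)

lemma Eul_diff: "A \<subseteq> Basis \<Longrightarrow> f \<in> S \<Longrightarrow> g \<in> S \<Longrightarrow> Eul A (f - g) = Eul A f - Eul A g"
  unfolding Eul_def by (simp add: d_diff subset_iff sum_subtractf right_diff_distrib cong: sum.cong)

lemma Eul_scale: "A \<subseteq> Basis \<Longrightarrow> f \<in> S \<Longrightarrow> Eul A (cscale c f) = cscale c (Eul A f)"
  unfolding Eul_def
  by (simp add: d_scale subset_iff cfun.scale_sum_right cscale_mult_right cong: sum.cong)

lemma Lap_zero: "Lap A (0 :: 'a \<Rightarrow> complex) = 0"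
  and Eul_zero: "Eul A (0 :: 'a \<Rightarrow> complex) = 0"
  by (simp_all add: Lap_def Eul_def d_zero)

lemma Lap_sum:
  assumes "A \<subseteq> Basis" "finite I" "\<And>i. i \<in> I \<Longrightarrow> F i \<in> S"
  shows "Lap A (\<Sum>i\<in>I. F i) = (\<Sum>i\<in>I. Lap A (F i))"
  using assms(2,3)
  by (induction I rule: finite_induct)
    (use assms(1) in \<open>simp_all add: Lap_add sum_closed Lap_zero\<close>)

lemma d_rsq:
  assumes "A \<subseteq> Basis" "b \<in> Basis" "f \<in> S"
  shows "dird b (rsq A * f) = rsq A * dird b f + (if b \<in> A then 2 * (coord b * f) else 0)"
proof -
  have fin: "finite A" using assms(1) finite_Basis finite_subset by blast
  have "dird b (rsq A * f) = (\<Sum>c\<in>A. dird b (coord c * (coord c * f)))"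
    unfolding rsq_def sum_distrib_right mult.assoc using assms fin
    by (subst d_sum) (auto intro!: closed)
  also have "\<dots> = (\<Sum>c\<in>A. coord c * coord c * dird b f + (if b = c then 2 * (coord b * f) else 0))"
    using assms by (intro sum.cong refl) (auto simp: d_coord closed subset_iff, auto simp: algebra_simps)
  also have "\<dots> = rsq A * dird b f + (if b \<in> A then 2 * (coord b * f) else 0)"
    using fin by (simp add: sum.distrib rsq_def sum_distrib_right)
  finally show ?thesis .
qed

lemma Lap_coord:
  assumes "A \<subseteq> Basis" "b \<in> Basis" "f \<in> S"
  shows "Lap A (coord b * f) = coord b * Lap A f + (if b \<in> A then 2 * dird b f else 0)"
proof -
  have fin: "finite A" using assms(1) finite_Basis finite_subset by blast
  have "Lap A (coord b * f) = (\<Sum>c\<in>A. coord b * dird c (dird c f) + (if b = c then 2 * dird b f else 0))"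
    unfolding Lap_def using assms
    by (intro sum.cong refl) (auto simp: d_coord d_add closed subset_iff d_zero)
  also have "\<dots> = coord b * Lap A f + (if b \<in> A then 2 * dird b f else 0)"
    using fin by (simp add: sum.distrib Lap_def sum_distrib_left)
  finally show ?thesis .
qed

lemma Eul_coord:
  assumes "A \<subseteq> Basis" "b \<in> Basis" "f \<in> S"
  shows "Eul A (coord b * f) = coord b * Eul A f + (if b \<in> A then coord b * f else 0)"
proof -
  have fin: "finite A" using assms(1) finite_Basis finite_subset by blast
  have "Eul A (coord b * f) = (\<Sum>c\<in>A. coord b * (coord c * dird c f) + (if b = c then coord b * f else 0))"
    unfolding Eul_def using assms
    by (intro sum.cong refl) (auto simp: d_coord d_add closed subset_iff, auto simp: algebra_simps)
  also have "\<dots> = coord b * Eul A f + (if b \<in> A then coord b * f else 0)"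
    using fin by (simp add: sum.distrib Eul_def sum_distrib_left)
  finally show ?thesis .
qed

lemma Lap_d:
  assumes "A \<subseteq> Basis" "b \<in> Basis" "f \<in> S"
  shows "Lap A (dird b f) = dird b (Lap A f)"
proof -
  have fin: "finite A" using assms(1) finite_Basis finite_subset by blast
  have eq: "dird c (dird c (dird b f)) = dird b (dird c (dird c f))" if "c \<in> A" for c
    using assms that dird_commute[of c b] dird_closed by (metis subsetD)
  have "Lap A (dird b f) = (\<Sum>c\<in>A. dird b (dird c (dird c f)))"
    unfolding Lap_def by (intro sum.cong refl eq)
  also have "\<dots> = dird b (Lap A f)"
    unfolding Lap_def using assms fin by (subst d_sum) (auto intro!: closed)
  finally show ?thesis .
qed

lemma Eul_d:
  assumes "A \<subseteq> Basis" "b \<in> Basis" "f \<in> S"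
  shows "Eul A (dird b f) = dird b (Eul A f) - (if b \<in> A then dird b f else 0)"
proof -
  have fin: "finite A" using assms(1) finite_Basis finite_subset by blast
  have "dird b (Eul A f) = (\<Sum>c\<in>A. dird b (coord c * dird c f))"
    unfolding Eul_def using assms fin by (subst d_sum) (auto intro!: closed)
  also have "\<dots> = (\<Sum>c\<in>A. coord c * dird c (dird b f) + (if b = c then dird b f else 0))"
    using assms by (intro sum.cong refl) (auto simp: d_coord closed subset_iff dird_commute[of b])
  also have "\<dots> = Eul A (dird b f) + (if b \<in> A then dird b f else 0)"
    using fin by (simp add: sum.distrib Eul_def)
  finally show ?thesis by simp
qed

lemma Lap_commute:
  assumes "A \<subseteq> Basis" "B \<subseteq> Basis" "f \<in> S"
  shows "Lap A (Lap B f) = Lap B (Lap A f)"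
proof -
  have fin: "finite B" using assms(2) finite_Basis finite_subset by blast
  have eq: "Lap A (dird b (dird b f)) = dird b (dird b (Lap A f))" if "b \<in> B" for b
    using assms that by (simp add: Lap_d closed subset_iff)
  have "Lap A (Lap B f) = (\<Sum>b\<in>B. Lap A (dird b (dird b f)))"
    unfolding Lap_def[of B] using assms fin by (subst Lap_sum) (auto intro!: closed)
  also have "\<dots> = Lap B (Lap A f)"
    unfolding Lap_def[of B] by (intro sum.cong refl eq)
  finally show ?thesis .
qed

lemma Lap_rsq:
  assumes "A \<subseteq> Basis" "f \<in> S"
  shows "Lap A (rsq A * f) = rsq A * Lap A f + cscale 4 (Eul A f) + cscale (2 * of_nat (card A)) f"
proof -
  have fin: "finite A" using assms(1) finite_Basis finite_subset by blast
  have "Lap A (rsq A * f) = (\<Sum>b\<in>A. rsq A * dird b (dird b f) + cscale 4 (coord b * dird b f) + cscale 2 f)"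
    unfolding Lap_def using assms
    by (intro sum.cong refl)
      (auto simp: d_coord d_add d_two d_rsq closed subset_iff, auto simp: cscale_def fun_eq_iff fun_apply algebra_simps)
  also have "\<dots> = rsq A * Lap A f + cscale 4 (Eul A f) + cscale (2 * of_nat (card A)) f"
    by (simp add: sum.distrib Lap_def Eul_def sum_distrib_left cfun.scale_sum_right)
      (simp add: cscale_def fun_eq_iff fun_apply)
  finally show ?thesis .
qed

lemma Lap_rsq_disjoint:
  assumes "A \<subseteq> Basis" "B \<subseteq> Basis" "A \<inter> B = {}" "f \<in> S"
  shows "Lap A (rsq B * f) = rsq B * Lap A f"
proof -
  have "dird b (dird b (rsq B * f)) = rsq B * dird b (dird b f)" if "b \<in> A" for b
    using assms that by (auto simp: d_rsq dird_closed subset_iff)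
  then show ?thesis by (simp add: Lap_def sum_distrib_left)
qed

lemma Eul_rsq:
  assumes "A \<subseteq> Basis" "B \<subseteq> Basis" "f \<in> S"
  shows "Eul A (rsq B * f) = rsq B * Eul A f + 2 * (rsq (A \<inter> B) * f)"
proof -
  have fin: "finite A" using assms(1) finite_Basis finite_subset by blast
  have "Eul A (rsq B * f) = (\<Sum>b\<in>A. rsq B * (coord b * dird b f)
      + (if b \<in> B then 2 * (coord b * coord b * f) else 0))"
    unfolding Eul_def using assms
    by (intro sum.cong refl) (auto simp: d_rsq subset_iff, auto simp: algebra_simps)
  also have "\<dots> = rsq B * Eul A f + 2 * (rsq (A \<inter> B) * f)"
    unfolding sum.distrib sum.inter_restrict[OF fin, symmetric]
    by (simp add: Eul_def rsq_def sum_distrib_left sum_distrib_right)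
  finally show ?thesis .
qed

lemma Eul_sum:
  assumes "A \<subseteq> Basis" "finite I" "\<And>i. i \<in> I \<Longrightarrow> F i \<in> S"
  shows "Eul A (\<Sum>i\<in>I. F i) = (\<Sum>i\<in>I. Eul A (F i))"
  using assms(2,3)
  by (induction I rule: finite_induct)
    (use assms(1) in \<open>simp_all add: Eul_add sum_closed Eul_zero\<close>)

lemma Eul_Lap:
  assumes "A \<subseteq> Basis" "B \<subseteq> Basis" "f \<in> S"
  shows "Eul A (Lap B f) = Lap B (Eul A f) - 2 * Lap (A \<inter> B) f"
proof -
  have fin: "finite B" using assms(2) finite_Basis finite_subset by blast
  have "Eul A (Lap B f) = (\<Sum>b\<in>B. Eul A (dird b (dird b f)))"
    unfolding Lap_def using assms fin by (subst Eul_sum) (auto intro!: closed)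
  also have "\<dots> = (\<Sum>b\<in>B. dird b (dird b (Eul A f)) - (if b \<in> A then 2 * dird b (dird b f) else 0))"
    using assms by (intro sum.cong refl) (auto simp: Eul_d d_diff closed subset_iff d_zero)
  also have "\<dots> = Lap B (Eul A f) - 2 * Lap (A \<inter> B) f"
    unfolding sum_subtractf sum.inter_restrict[OF fin, symmetric]
    by (simp add: Lap_def sum_distrib_left Int_commute)
  finally show ?thesis .
qed

end

section \<open>Modules generated over the polynomials\<close>

text \<open>The module over the ring of polynomials that is generated by a set \<open>G\<close> of functions.\<close>

inductive_set polymod :: "('a::euclidean_space \<Rightarrow> complex) set \<Rightarrow> ('a \<Rightarrow> complex) set"
  for G :: "('a \<Rightarrow> complex) set" where
  gen: "g \<in> G \<Longrightarrow> g \<in> polymod G"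
| zero: "0 \<in> polymod G"
| add: "f \<in> polymod G \<Longrightarrow> g \<in> polymod G \<Longrightarrow> f + g \<in> polymod G"
| scale: "f \<in> polymod G \<Longrightarrow> cscale c f \<in> polymod G"
| coord: "b \<in> Basis \<Longrightarrow> f \<in> polymod G \<Longrightarrow> coord b * f \<in> polymod G"

lemma subspace_polymod: "cfun.subspace (polymod G)"
  by (rule cfun.subspaceI) (auto intro: polymod.intros)

lemma times_fun_differentiable:
  fixes f g :: "'a::real_normed_vector \<Rightarrow> complex"
  assumes "f differentiable (at z)" "g differentiable (at z)"
  shows "(f * g) differentiable (at z)"
  using differentiable_mult[OF assms] by (simp add: times_fun_def)

lemma plus_fun_differentiable:
  fixes f g :: "'a::real_normed_vector \<Rightarrow> complex"
  assumes "f differentiable (at z)" "g differentiable (at z)"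
  shows "(f + g) differentiable (at z)"
  using differentiable_add[OF assms] by (simp add: plus_fun_def)

lemma cscale_differentiable:
  fixes f :: "'a::real_normed_vector \<Rightarrow> complex"
  assumes "f differentiable (at z)"
  shows "cscale c f differentiable (at z)"
  unfolding cscale_def using assms by (intro differentiable_mult) auto

text \<open>
  Only the generators have to be checked: by the Leibniz rule all conditions pass from \<open>f\<close> to
  \<open>coord b * f\<close>.
\<close>

lemma diff_module_polymod:
  fixes G :: "('a::euclidean_space \<Rightarrow> complex) set"
  assumes diffG: "\<And>g z. g \<in> G \<Longrightarrow> g differentiable (at z)"
    and dG: "\<And>g b. g \<in> G \<Longrightarrow> b \<in> Basis \<Longrightarrow> dird b g \<in> polymod G"
    and commG: "\<And>g b c. g \<in> G \<Longrightarrow> b \<in> Basis \<Longrightarrow> c \<in> Basis \<Longrightarrow>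
      dird b (dird c g) = dird c (dird b g)"
  shows "diff_module (polymod G)"
proof
  show smooth: "f differentiable (at z)" if "f \<in> polymod G" for f z
    using that
  proof (induction rule: polymod.induct)
    case zero
    then show ?case by (simp add: zero_fun_def)
  qed (auto intro: diffG times_fun_differentiable plus_fun_differentiable
      cscale_differentiable coord_differentiable)
  have d_zero: "dird b (0 :: 'a \<Rightarrow> complex) = 0" for b
    using dird_const[of b 0] by (simp add: zero_fun_def)
  show closed: "dird b f \<in> polymod G" if "b \<in> Basis" "f \<in> polymod G" for b f
    using that(2)
  proof (induction rule: polymod.induct)
    case (coord c f)
    then show ?case
      using that(1) by (auto simp: dird_coord_mult smooth intro: polymod.intros)
  qed (use that(1) in \<open>auto simp: dird_add dird_cscale smooth dG d_zero intro!: polymod.intros(2-5)\<close>)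
  show "dird b (dird c f) = dird c (dird b f)"
    if "b \<in> Basis" "c \<in> Basis" "f \<in> polymod G" for b c f
    using that(3)
  proof (induction rule: polymod.induct)
    case (coord e f)
    have "dird b' (dird c' (coord e * f)) = coord e * dird b' (dird c' f)
        + (if b' = e then dird c' f else 0) + (if c' = e then dird b' f else 0)"
      if "b' \<in> Basis" "c' \<in> Basis" for b' c'
      using that coord
      by (auto simp: dird_coord_mult dird_add smooth closed d_zero polymod.intros)
    then show ?case
      using that coord.IH by (simp add: add.commute add.left_commute)
  qed (use that in \<open>auto simp: dird_add dird_cscale smooth closed commG d_zero\<close>)
  show "coord b * f \<in> polymod G" if "b \<in> Basis" "f \<in> polymod G" for b f
    using that by (rule polymod.coord)
qed (rule subspace_polymod)

text \<open>The complex-valued polynomial functions, as the module generated by the constant \<open>1\<close>.\<close>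

abbreviation polys :: "('a::euclidean_space \<Rightarrow> complex) set" where
  "polys \<equiv> polymod {1}"

global_interpretation polys: diff_module "polys :: ('a::euclidean_space \<Rightarrow> complex) set"
proof (rule diff_module_polymod)
  fix g :: "'a \<Rightarrow> complex" and z b c
  assume "g \<in> {1}"
  then have g: "g = (\<lambda>z. 1)" by (simp add: one_fun_def)
  show "g differentiable (at z)" by (simp add: g)
  show "dird b g \<in> polys" by (simp add: g dird_const polymod.zero)
  show "dird b (dird c g) = dird c (dird b g)"
    using dird_const[of _ 0] by (simp add: g dird_const zero_fun_def)
qed

lemma poly_mult_closed:
  assumes "p \<in> polys" "f \<in> polymod G"
  shows "p * f \<in> polymod G"
  using assms(1)
proof (induction rule: polymod.induct)
  case (add p q)
  then show ?case by (simp add: distrib_right polymod.add)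
qed (auto simp: assms(2) mult.assoc cscale_mult_left intro: polymod.intros(2-5))

lemma one_poly: "1 \<in> polys"
  by (simp add: polymod.gen)

lemma coord_poly: "b \<in> Basis \<Longrightarrow> coord b \<in> polys"
  using polymod.coord[OF _ one_poly, of b] by simp

lemma const_poly: "(\<lambda>z. c) \<in> polys"
  using polymod.scale[OF one_poly, of c] by (simp add: cscale_def fun_apply)

lemma power_poly: "p \<in> polys \<Longrightarrow> p ^ n \<in> polys"
  by (induction n) (simp_all add: one_poly poly_mult_closed)

lemma rsq_poly: "A \<subseteq> Basis \<Longrightarrow> rsq A \<in> polys"
  using polys.rsq_closed[OF _ one_poly, of A] by simp

lemma real_polynomial_function_polys:
  assumes "real_polynomial_function f"
  shows "(\<lambda>z. complex_of_real (f z)) \<in> polys"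
  using assms
proof (induction rule: real_polynomial_function.induct)
  case (linear f)
  have "(\<lambda>z. complex_of_real (f z)) = (\<Sum>b\<in>Basis. cscale (of_real (f b)) (coord b))"
  proof
    fix z
    have "f z = f (\<Sum>b\<in>Basis. (z \<bullet> b) *\<^sub>R b)" by (simp add: euclidean_representation)
    also have "\<dots> = (\<Sum>b\<in>Basis. (z \<bullet> b) * f b)"
      using linear by (simp add: linear_sum linear_scale bounded_linear.linear)
    finally show "complex_of_real (f z) = (\<Sum>b\<in>Basis. cscale (of_real (f b)) (coord b)) z"
      by (simp add: fun_sum_apply cscale_def coord_def mult.commute)
  qed
  also have "\<dots> \<in> polys"
    by (intro polys.sum_closed polymod.scale coord_poly)
  finally show ?case .
next
  case (add f g)
  then show ?case using polymod.add by (fastforce simp: plus_fun_def)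
next
  case (mult f g)
  then show ?case using poly_mult_closed by (fastforce simp: times_fun_def)
qed (rule const_poly)

lemma polynomial_function_polys:
  assumes "polynomial_function (f :: 'a::euclidean_space \<Rightarrow> complex)"
  shows "f \<in> polys"
proof -
  have "real_polynomial_function (Re \<circ> f)" "real_polynomial_function (Im \<circ> f)"
    using assms bounded_linear_Re bounded_linear_Im unfolding polynomial_function_def by auto
  then have "(\<lambda>z. complex_of_real (Re (f z))) + cscale \<i> (\<lambda>z. complex_of_real (Im (f z))) \<in> polys"
    using real_polynomial_function_polys by (intro polymod.add polymod.scale) (auto simp: o_def)
  moreover have "(\<lambda>z. complex_of_real (Re (f z))) + cscale \<i> (\<lambda>z. complex_of_real (Im (f z))) = f"
    by (simp add: fun_eq_iff fun_apply cscale_def flip: complex_eq)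
  ultimately show ?thesis by simp
qed

lemma poly_compose:
  assumes "f \<in> polys" "bounded_linear L"
  shows "(\<lambda>z. f (L z)) \<in> polys"
  using assms(1)
proof (induction rule: polymod.induct)
  case (gen g)
  then show ?case using one_poly by (simp add: one_fun_def)
next
  case zero
  then show ?case using polymod.zero by (simp add: zero_fun_def)
next
  case (add f g)
  then show ?case using polymod.add by (fastforce simp: plus_fun_def)
next
  case (scale f c)
  then show ?case using polymod.scale by (fastforce simp: cscale_def)
next
  case (coord b f)
  have "bounded_linear (\<lambda>z. L z \<bullet> b)"
    using assms(2) by (rule bounded_linear_inner_left_comp)
  then have "(\<lambda>z. coord b (L z)) \<in> polys"
    unfolding coord_def by (intro real_polynomial_function_polys real_polynomial_function.intros(1))
  from poly_mult_closed[OF this coord.IH] show ?case by (simp add: times_fun_def)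
qed

section \<open>Homogeneous polynomials and the Fischer decomposition\<close>

text \<open>
  Homogeneous polynomials of degree \<open>k\<close>. The zero polynomial is homogeneous of every degree, which
  makes truncated subtraction of degrees harmless below: \<open>\<partial>\<^sub>b f\<close> is homogeneous of degree \<open>k - 1\<close>
  also if \<open>k = 0\<close>.
\<close>

inductive hpoly :: "nat \<Rightarrow> ('a::euclidean_space \<Rightarrow> complex) \<Rightarrow> bool" where
  one: "hpoly 0 1"
| zero: "hpoly k 0"
| add: "hpoly k f \<Longrightarrow> hpoly k g \<Longrightarrow> hpoly k (f + g)"
| scale: "hpoly k f \<Longrightarrow> hpoly k (cscale c f)"
| coord: "b \<in> Basis \<Longrightarrow> hpoly k f \<Longrightarrow> hpoly (Suc k) (coord b * f)"

lemma hpoly_polys: "hpoly k f \<Longrightarrow> f \<in> polys"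
  by (induction rule: hpoly.induct) (auto intro: polymod.intros one_poly)

lemma hpoly_sum:
  "(\<And>i. i \<in> I \<Longrightarrow> hpoly k (F i)) \<Longrightarrow> hpoly k (\<Sum>i\<in>I. F i)"
  by (induction I rule: infinite_finite_induct) (auto intro: hpoly.intros)

lemma hpoly_homogeneous: "hpoly k f \<Longrightarrow> f (t *\<^sub>R x) = complex_of_real t ^ k * f x"
  by (induction rule: hpoly.induct) (simp_all add: cscale_def coord_def fun_apply algebra_simps)

lemma hpoly_polynomial_function:
  assumes "hpoly k f"
  shows "polynomial_function f"
  using assms
proof (induction rule: hpoly.induct)
  case (add k f g)
  then show ?case by (simp add: plus_fun_def polynomial_function_add)
next
  case (scale k f c)
  show ?case unfolding polynomial_function_def
  proof (intro allI impI)
    fix h :: "complex \<Rightarrow> real" assume "bounded_linear h"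
    then have "bounded_linear (\<lambda>w. h (c * w))"
      using bounded_linear_compose bounded_linear_mult_right by blast
    then show "real_polynomial_function (h \<circ> cscale c f)"
      using scale.IH unfolding polynomial_function_def cscale_def o_def by blast
  qed
next
  case (coord b k f)
  have "polynomial_function (\<lambda>z. z \<bullet> b)"
    by (intro polynomial_function_bounded_linear bounded_linear_inner_left)
  from polynomial_function_mult[OF this coord.IH]
  show ?case by (simp add: coord_def times_fun_def scaleR_conv_of_real)
qed (simp_all add: one_fun_def zero_fun_def)

lemma dird_one: "dird v 1 = 0"
  using dird_const[of v 1] by (simp add: one_fun_def)

lemma dird_hpoly:
  assumes "hpoly k f" "b \<in> Basis"
  shows "hpoly (k - 1) (dird b f) \<and> (k = 0 \<longrightarrow> dird b f = 0)"
  using assms(1)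
proof (induction rule: hpoly.induct)
  case one
  then show ?case by (simp add: dird_one hpoly.zero)
next
  case (zero k)
  then show ?case by (simp add: polys.d_zero hpoly.zero)
next
  case (add k f g)
  then show ?case by (auto simp: polys.d_add hpoly_polys intro: hpoly.intros)
next
  case (scale k f c)
  then show ?case by (auto simp: polys.d_scale hpoly_polys intro: hpoly.intros)
next
  case (coord c k f)
  have "hpoly k (coord c * dird b f)"
    using coord hpoly.coord[OF coord.hyps(1), of "k - 1" "dird b f"]
    by (cases "k = 0") (auto intro: hpoly.zero)
  then show ?case
    using coord assms(2) by (auto simp: polys.d_coord hpoly_polys intro: hpoly.intros)
qed

lemma Lap_hpoly:
  assumes "hpoly k f" "A \<subseteq> Basis"
  shows "hpoly (k - 2) (Lap A f) \<and> (k < 2 \<longrightarrow> Lap A f = 0)"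
proof -
  have "hpoly (k - 2) (dird b (dird b f)) \<and> (k < 2 \<longrightarrow> dird b (dird b f) = 0)" if "b \<in> A" for b
  proof -
    have b: "b \<in> Basis" using that assms(2) by blast
    show ?thesis
      using dird_hpoly[OF assms(1) b] dird_hpoly[OF conjunct1[OF dird_hpoly[OF assms(1) b]] b]
      by (auto simp: numeral_2_eq_2)
  qed
  then show ?thesis
    unfolding Lap_def by (auto intro!: hpoly_sum)
qed

lemma Lap_pow_hpoly:
  assumes "hpoly k f" "A \<subseteq> Basis"
  shows "hpoly (k - 2 * j) ((Lap A ^^ j) f) \<and> (k < 2 * j \<longrightarrow> (Lap A ^^ j) f = 0)"
proof (induction j)
  case (Suc j)
  have "k - 2 * j - 2 = k - 2 * Suc j" by simp
  then show ?case
    using Suc Lap_hpoly[OF conjunct1[OF Suc] assms(2)]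
    by (cases "k < 2 * j") (auto simp: polys.Lap_zero)
qed (use assms in auto)

lemma Eul_hpoly:
  assumes "hpoly k f"
  shows "Eul Basis f = cscale (of_nat k) f"
  using assms
proof (induction rule: hpoly.induct)
  case one
  then show ?case
    by (simp add: Eul_def dird_one)
next
  case (zero k)
  then show ?case by (simp add: polys.Eul_zero)
next
  case (add k f g)
  then show ?case by (simp add: polys.Eul_add hpoly_polys cfun.scale_right_distrib)
next
  case (scale k f c)
  then show ?case by (simp add: polys.Eul_scale hpoly_polys mult.commute)
next
  case (coord b k f)
  then show ?case
    by (simp add: polys.Eul_coord hpoly_polys) (simp add: cscale_def fun_eq_iff fun_apply algebra_simps)
qed

lemma hpoly_rsq:
  assumes "hpoly k f" "A \<subseteq> Basis"
  shows "hpoly (k + 2) (rsq A * f)"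
  unfolding rsq_def sum_distrib_right mult.assoc
  using assms by (auto intro!: hpoly_sum hpoly.coord simp: numeral_2_eq_2)

lemma hpoly_rsq_power:
  assumes "hpoly k f" "A \<subseteq> Basis"
  shows "hpoly (k + 2 * j) (rsq A ^ j * f)"
proof (induction j)
  case (Suc j)
  then show ?case
    using hpoly_rsq[OF Suc assms(2)] by (simp add: mult.assoc algebra_simps)
qed (use assms in simp)

text \<open>
  The classical formula \<open>\<Delta> (r\<^sup>2\<^sup>j\<^sup>+\<^sup>2 h) = 2 (j + 1) (n + 2 j + 2 l) r\<^sup>2\<^sup>j h\<close> for a harmonic polynomial
  \<open>h\<close> of degree \<open>l\<close> in \<open>n\<close> variables; the factor is nonzero because \<open>n > 0\<close>.
\<close>

lemma Lap_rsq_power: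
  fixes h :: "'a::euclidean_space \<Rightarrow> complex"
  assumes h: "hpoly l h" "Lap Basis h = 0"
  shows "Lap Basis (rsq Basis ^ Suc j * h)
    = cscale (of_nat (2 * Suc j * (DIM('a) + 2 * j + 2 * l))) (rsq Basis ^ j * h)"
proof (induction j)
  case 0
  show ?case
    by (simp add: polys.Lap_rsq hpoly_polys[OF h(1)] h(2) Eul_hpoly[OF h(1)])
      (simp add: cscale_def fun_eq_iff fun_apply algebra_simps)
next
  case (Suc j)
  have hp: "hpoly (l + 2 * Suc j) (rsq Basis ^ Suc j * h)"
    using h(1) by (rule hpoly_rsq_power) simp
  have "Lap Basis (rsq Basis ^ Suc (Suc j) * h) = Lap Basis (rsq Basis * (rsq Basis ^ Suc j * h))"
    by (simp only: power_Suc mult.assoc)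
  also have "\<dots> = rsq Basis * Lap Basis (rsq Basis ^ Suc j * h)
      + cscale 4 (Eul Basis (rsq Basis ^ Suc j * h))
      + cscale (2 * of_nat DIM('a)) (rsq Basis ^ Suc j * h)"
    by (rule polys.Lap_rsq) (use hp hpoly_polys in auto)
  also have "\<dots> = cscale (of_nat (2 * Suc (Suc j) * (DIM('a) + 2 * Suc j + 2 * l)))
      (rsq Basis ^ Suc j * h)"
    unfolding Suc Eul_hpoly[OF hp]
    by (simp add: cscale_def fun_eq_iff fun_apply algebra_simps)
  finally show ?case .
qed

lemma Lap_pow_scale:
  "f \<in> polys \<Longrightarrow> (Lap Basis ^^ j) (cscale c f) = cscale c ((Lap Basis ^^ j) f)
     \<and> (Lap Basis ^^ j) f \<in> polys"
  by (induction j) (auto simp: polys.Lap_scale polys.Lap_closed)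

lemma Lap_pow_diff:
  "f \<in> polys \<Longrightarrow> g \<in> polys \<Longrightarrow>
    (Lap Basis ^^ j) (f - g) = (Lap Basis ^^ j) f - (Lap Basis ^^ j) g"
  by (induction j) (auto simp: polys.Lap_diff Lap_pow_scale)

lemma Lap_pow_rsq_power:
  fixes h :: "'a::euclidean_space \<Rightarrow> complex"
  assumes h: "hpoly l h" "Lap Basis h = 0"
  shows "\<exists>c. c \<noteq> 0 \<and> (Lap Basis ^^ j) (rsq Basis ^ j * h) = cscale c h"
proof (induction j)
  case 0
  show ?case by (rule exI[of _ 1]) (simp add: cscale_def fun_eq_iff fun_apply)
next
  case (Suc j)
  then obtain c where c: "c \<noteq> 0" "(Lap Basis ^^ j) (rsq Basis ^ j * h) = cscale c h" by blast
  define d where "d = (of_nat (2 * Suc j * (DIM('a) + 2 * j + 2 * l)) :: complex)"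
  have "d \<noteq> 0" unfolding d_def of_nat_eq_0_iff by simp
  have "rsq Basis ^ j * h \<in> polys"
    using hpoly_rsq_power[OF h(1) order_refl] by (rule hpoly_polys)
  then have "(Lap Basis ^^ Suc j) (rsq Basis ^ Suc j * h) = cscale (d * c) h"
    unfolding funpow_Suc_right o_def Lap_rsq_power[OF h] d_def[symmetric]
    by (simp add: Lap_pow_scale c(2))
  with c(1) \<open>d \<noteq> 0\<close> show ?case by (metis mult_eq_0_iff)
qed

text \<open>The products of a power of \<open>r\<^sup>2\<close> and a homogeneous harmonic polynomial.\<close>

definition fischer_gens :: "('a::euclidean_space \<Rightarrow> complex) set" where
  "fischer_gens = {rsq Basis ^ a * h | a h l. hpoly l h \<and> Lap Basis h = 0}"

text \<open>
  Fischer decomposition of a homogeneous polynomial \<open>f\<close> with \<open>\<Delta>\<^sup>s f = 0\<close>. In the induction step,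
  where \<open>\<Delta>\<^sup>s\<^sup>+\<^sup>1 f = 0\<close>, the polynomial \<open>h = \<Delta>\<^sup>s f\<close> is harmonic and \<open>\<Delta>\<^sup>s (r\<^sup>2\<^sup>s h)\<close> is a nonzero multiple
  of \<open>h\<close>; hence \<open>\<Delta>\<^sup>s\<close> kills the difference of \<open>f\<close> and a multiple of \<open>r\<^sup>2\<^sup>s h\<close>. No inner product on
  polynomials is needed.
\<close>

lemma hpoly_span_fischer_gens:
  assumes "hpoly k f" "(Lap Basis ^^ s) f = 0"
  shows "f \<in> cfun.span fischer_gens"
  using assms
proof (induction s arbitrary: f)
  case 0
  then show ?case by (simp add: cfun.span_zero)
next
  case (Suc s)
  define h where "h = (Lap Basis ^^ s) f"
  show ?case
  proof (cases "h = 0")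
    case True
    then show ?thesis using Suc h_def by simp
  next
    case False
    have k: "2 * s \<le> k" and hp: "hpoly (k - 2 * s) h"
      using Lap_pow_hpoly[OF Suc.prems(1) order_refl, of s] False by (auto simp: h_def)
    have Lh: "Lap Basis h = 0" using Suc.prems(2) by (simp add: h_def)
    obtain c where c: "c \<noteq> 0" "(Lap Basis ^^ s) (rsq Basis ^ s * h) = cscale c h"
      using Lap_pow_rsq_power[OF hp Lh] by blast
    define g where "g = rsq Basis ^ s * h"
    have g: "hpoly k g"
      using hpoly_rsq_power[OF hp order_refl, of s] k by (simp add: g_def)
    have f': "hpoly k (f - cscale (1 / c) g)"
      using hpoly.add[OF Suc.prems(1) hpoly.scale[OF g, of "- 1 / c"]]
      by (simp add: cscale_def fun_diff_def plus_fun_def)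
    have "(Lap Basis ^^ s) (f - cscale (1 / c) g) = h - cscale (1 / c) (cscale c h)"
      using g Suc.prems(1) c(2)
      by (simp add: Lap_pow_diff Lap_pow_scale polymod.scale hpoly_polys h_def g_def)
    also have "\<dots> = 0" using c(1) by simp
    finally have "f - cscale (1 / c) g \<in> cfun.span fischer_gens"
      using Suc.IH f' by blast
    moreover have "g \<in> cfun.span fischer_gens"
      using hp Lh by (auto simp: fischer_gens_def g_def intro!: cfun.span_base)
    ultimately have "(f - cscale (1 / c) g) + cscale (1 / c) g \<in> cfun.span fischer_gens"
      by (intro cfun.span_add cfun.span_scale)
    then show ?thesis by simp
  qed
qed

lemma mult_span_closed:
  fixes u :: "'a \<Rightarrow> complex"
  assumes "f \<in> cfun.span X" "cfun.subspace T" "\<And>g. g \<in> X \<Longrightarrow> u * g \<in> T"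
  shows "u * f \<in> T"
proof -
  have "cfun.subspace {f. u * f \<in> T}"
    using assms(2) unfolding cfun.subspace_def by (simp add: distrib_left cscale_mult_right)
  then show ?thesis
    using cfun.span_minimal[of X "{f. u * f \<in> T}"] assms(1,3) by blast
qed

lemma polys_span_fischer_gens:
  fixes f :: "'a::euclidean_space \<Rightarrow> complex"
  assumes "f \<in> polys"
  shows "f \<in> cfun.span fischer_gens"
  using assms
proof (induction rule: polymod.induct)
  case (gen g)
  have "Lap Basis 1 = (0 :: 'a \<Rightarrow> complex)"
    by (simp add: Lap_hpoly[OF hpoly.one order_refl])
  then have "g \<in> fischer_gens"
    using gen hpoly.one unfolding fischer_gens_def
    by (intro CollectI exI[of _ 0] exI[of _ 1]) auto
  then show ?case by (rule cfun.span_base)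
next
  case (coord b f)
  show ?case
  proof (rule mult_span_closed[OF coord.IH])
    fix g :: "'a \<Rightarrow> complex"
    assume "g \<in> fischer_gens"
    then obtain k where "hpoly k g"
      unfolding fischer_gens_def using hpoly_rsq_power by blast
    then have "hpoly (Suc k) (coord b * g)" using coord.hyps(1) by (rule hpoly.coord[rotated])
    then show "coord b * g \<in> cfun.span fischer_gens"
      \<comment> \<open>\<open>Suc k\<close> applications of the Laplacian lower the degree below zero.\<close>
      using Lap_pow_hpoly[OF _ order_refl, of "Suc k" _ "Suc k"] hpoly_span_fischer_gens by fastforce
  qed simp
qed (auto intro: cfun.span_zero cfun.span_add cfun.span_scale)

section \<open>The functions Psi\<close>

lemma pochhammer_nonzero:
  assumes "\<alpha> \<notin> \<int>\<^sub>\<le>\<^sub>0"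
  shows "pochhammer \<alpha> n \<noteq> (0 :: complex)"
  using assms by (auto simp: pochhammer_eq_0_iff)

lemma summable_Psi:
  assumes "\<alpha> \<notin> \<int>\<^sub>\<le>\<^sub>0"
  shows "summable (\<lambda>n. (- 1) ^ n / (fact n * pochhammer \<alpha> n) * u ^ n :: complex)"
proof -
  \<comment> \<open>From \<open>N\<close> on, \<open>\<alpha> + n\<close> has norm at least 1, and \<open>norm u / (n + 1)\<close> is at most 1/2.\<close>
  define N where "N = nat \<lceil>2 * norm u + norm \<alpha> + 1\<rceil>"
  show ?thesis
  proof (rule summable_ratio_test[of "1 / 2" N])
    fix n assume "n \<ge> N"
    then have n: "real n \<ge> 2 * norm u + norm \<alpha> + 1" unfolding N_def by linarith
    have "norm (\<alpha> + of_nat n) \<ge> real n - norm \<alpha>"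
      using norm_diff_ineq[of "of_nat n" \<alpha>] by (simp add: add.commute)
    then have an: "norm (\<alpha> + of_nat n) \<ge> 1" using n norm_ge_zero[of u] by linarith
    let ?a = "\<lambda>n. (- 1) ^ n / (fact n * pochhammer \<alpha> n) * u ^ n"
    have "norm u / (norm (1 + of_nat n :: complex) * norm (\<alpha> + of_nat n)) \<le> norm u / real (Suc n)"
    proof (rule divide_left_mono)
      have "norm (1 + of_nat n :: complex) = real (Suc n)"
        by (metis norm_of_nat of_nat_Suc)
      then show "real (Suc n) \<le> norm (1 + of_nat n :: complex) * norm (\<alpha> + of_nat n)"
        "0 < norm (1 + of_nat n :: complex) * norm (\<alpha> + of_nat n) * real (Suc n)"
        using an mult_left_mono[of 1 "norm (\<alpha> + of_nat n)" "real (Suc n)"]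
        by (auto intro!: mult_pos_pos)
    qed simp
    also have "\<dots> \<le> 1 / 2"
    proof -
      have "2 * norm u \<le> real (Suc n)" using n norm_ge_zero[of \<alpha>] by linarith
      then show ?thesis by (simp add: field_simps)
    qed
    finally have "norm u / (norm (1 + of_nat n :: complex) * norm (\<alpha> + of_nat n)) \<le> 1 / 2" .
    moreover have "norm (?a (Suc n))
        = norm u / (norm (1 + of_nat n :: complex) * norm (\<alpha> + of_nat n)) * norm (?a n)"
      by (simp add: norm_mult norm_divide norm_power pochhammer_Suc mult_ac)
    ultimately show "norm (?a (Suc n)) \<le> 1 / 2 * norm (?a n)"
      by (simp only: mult_right_mono norm_ge_zero)
  qed simp
qed

lemma Psi_has_field_derivative:
  assumes "\<alpha> \<notin> \<int>\<^sub>\<le>\<^sub>0"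
  shows "(Psi \<alpha> has_field_derivative (- 1 / \<alpha>) * Psi (\<alpha> + 1) u) (at u)"
proof -
  let ?c = "\<lambda>n. (- 1) ^ n / (fact n * pochhammer \<alpha> n) :: complex"
  have \<alpha>: "\<alpha> \<noteq> 0" using assms by auto
  have \<alpha>1: "\<alpha> + 1 \<notin> \<int>\<^sub>\<le>\<^sub>0" using assms plus_one_in_nonpos_Ints_imp by blast
  have diffs: "diffs ?c n = (- 1 / \<alpha>) * ((- 1) ^ n / (fact n * pochhammer (\<alpha> + 1) n))" for n
    using \<alpha> pochhammer_nonzero[OF \<alpha>1, of n]
    by (simp add: diffs_def pochhammer_rec field_simps del: of_nat_Suc)
  have "((\<lambda>u. \<Sum>n. ?c n * u ^ n) has_field_derivative (\<Sum>n. diffs ?c n * u ^ n)) (at u)"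
    using summable_Psi[OF assms] by (rule termdiffs_strong_converges_everywhere)
  moreover have "(\<Sum>n. diffs ?c n * u ^ n) = (- 1 / \<alpha>) * Psi (\<alpha> + 1) u"
    unfolding diffs Psi_def using suminf_mult[OF summable_Psi[OF \<alpha>1], of "- 1 / \<alpha>" u]
    by (simp add: mult.assoc)
  moreover have "(\<lambda>u. \<Sum>n. ?c n * u ^ n) = Psi \<alpha>"
    by (simp add: Psi_def fun_eq_iff)
  ultimately show ?thesis by simp
qed

lemma Psi_comp_has_derivative:
  assumes "\<alpha> \<notin> \<int>\<^sub>\<le>\<^sub>0" "w differentiable (at z)"
  shows "((\<lambda>z. Psi \<alpha> (w z)) has_derivative
     (\<lambda>v. (- 1 / \<alpha>) * Psi (\<alpha> + 1) (w z) * frechet_derivative w (at z) v)) (at z)"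
proof -
  have "(w has_derivative frechet_derivative w (at z)) (at z)"
    using assms(2) frechet_derivative_works by blast
  moreover have "(Psi \<alpha> has_derivative (*) ((- 1 / \<alpha>) * Psi (\<alpha> + 1) (w z))) (at (w z))"
    using Psi_has_field_derivative[OF assms(1)] by (simp add: has_field_derivative_def)
  ultimately show ?thesis
    using diff_chain_at by (fastforce simp: o_def)
qed

lemma Psi_comp_dird:
  assumes "\<alpha> \<notin> \<int>\<^sub>\<le>\<^sub>0" "\<And>z. w differentiable (at z)"
  shows "dird v (\<lambda>z. Psi \<alpha> (w z)) = cscale (- 1 / \<alpha>) ((\<lambda>z. Psi (\<alpha> + 1) (w z)) * dird v w)"
  by (rule ext, subst dird_eq[OF Psi_comp_has_derivative[OF assms]])
    (simp add: cscale_def fun_apply dird_frechet assms(2))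

text \<open>
  The set of all \<open>Psi \<alpha> \<circ> w\<close> is stable under partial derivatives up to polynomial factors. Second
  derivatives are symmetric because those of the polynomial \<open>w\<close> are.
\<close>

lemma diff_module_Psi:
  fixes w :: "'a::euclidean_space \<Rightarrow> complex"
  assumes w: "w \<in> polys"
  shows "diff_module (polymod {\<lambda>z. Psi \<alpha> (w z) | \<alpha>. \<alpha> \<notin> \<int>\<^sub>\<le>\<^sub>0})" (is "diff_module (polymod ?G)")
proof (rule diff_module_polymod)
  have w_diff: "w differentiable (at z)" for z using w by (rule polys.smooth)
  fix g z and b c :: 'a
  assume "g \<in> ?G"
  then obtain \<alpha> where \<alpha>: "\<alpha> \<notin> \<int>\<^sub>\<le>\<^sub>0" and g: "g = (\<lambda>z. Psi \<alpha> (w z))" by blast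
  have \<alpha>1: "\<alpha> + 1 \<notin> \<int>\<^sub>\<le>\<^sub>0" using \<alpha> plus_one_in_nonpos_Ints_imp by blast
  have diff: "(\<lambda>z. Psi \<alpha> (w z)) differentiable (at z)" if "\<alpha> \<notin> \<int>\<^sub>\<le>\<^sub>0" for \<alpha> z
    using Psi_comp_has_derivative[OF that w_diff] differentiable_def by blast
  show "g differentiable (at z)" unfolding g by (rule diff[OF \<alpha>])
  assume b: "b \<in> Basis"
  have "dird b w * (\<lambda>z. Psi (\<alpha> + 1) (w z)) \<in> polymod ?G"
    using b w \<alpha>1 by (intro poly_mult_closed[OF polys.dird_closed[OF b w]] polymod.gen) auto
  then show "dird b g \<in> polymod ?G"
    unfolding g Psi_comp_dird[OF \<alpha> w_diff] mult.commute[of _ "dird b w"]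
    by (rule polymod.scale)
  assume c: "c \<in> Basis"
  define c0 c1 where "c0 = - 1 / \<alpha>" and "c1 = - 1 / (\<alpha> + 1)"
  note d0 = Psi_comp_dird[OF \<alpha> w_diff, folded c0_def]
  note d1 = Psi_comp_dird[OF \<alpha>1 w_diff, folded c1_def]
  have dd: "dird b (dird c g) = cscale c0 (cscale c1
      ((\<lambda>z. Psi (\<alpha> + 1 + 1) (w z)) * dird b w * dird c w)
      + (\<lambda>z. Psi (\<alpha> + 1) (w z)) * dird b (dird c w))"
    if "b \<in> Basis" "c \<in> Basis" for b c
  proof -
    have dw: "\<And>z. dird c w differentiable (at z)"
      using w that polys.smooth polys.dird_closed by blast
    show ?thesis
      unfolding g d0
      by (simp add: dird_cscale dird_mult times_fun_differentiable diff[OF \<alpha>1] dw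
          d1 cscale_mult_left)
  qed
  show "dird b (dird c g) = dird c (dird b g)"
    unfolding dd[OF b c] dd[OF c b] using polys.dird_commute[OF b c w]
    by (simp add: mult.assoc mult.commute[of "dird b w"])
qed

section \<open>Operators commuting with the Lie algebra\<close>

text \<open>
  Let \<open>A\<close> and \<open>B\<close> be disjoint sets of coordinates. Up to scalar factors, \<open>Xop A B\<close> and \<open>Xop B A\<close> are
  the operators \<open>opXplus\<close> and \<open>opXminus\<close>, which allows both to be treated at once. The operator
  \<open>opH\<close> differs from \<open>Eul B - Eul A\<close> by a scalar. The Lie algebra acts by \<open>Rot b c\<close> for two
  coordinates of the same set, and by multiples of \<open>Mix b c\<close> for coordinates of different sets.
\<close>

definition Xop :: "'a::euclidean_space set \<Rightarrow> 'a set \<Rightarrow> ('a \<Rightarrow> complex) \<Rightarrow> 'a \<Rightarrow> complex" where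
  "Xop A B f = Lap A f + rsq B * f"

definition Rot :: "'a::euclidean_space \<Rightarrow> 'a \<Rightarrow> ('a \<Rightarrow> complex) \<Rightarrow> 'a \<Rightarrow> complex" where
  "Rot b c f = coord b * dird c f - coord c * dird b f"

definition Mix :: "'a::euclidean_space \<Rightarrow> 'a \<Rightarrow> ('a \<Rightarrow> complex) \<Rightarrow> 'a \<Rightarrow> complex" where
  "Mix b c f = coord b * (coord c * f) + dird b (dird c f)"

context diff_module
begin

lemma Xop_closed: "A \<subseteq> Basis \<Longrightarrow> B \<subseteq> Basis \<Longrightarrow> f \<in> S \<Longrightarrow> Xop A B f \<in> S"
  and Rot_closed: "b \<in> Basis \<Longrightarrow> c \<in> Basis \<Longrightarrow> f \<in> S \<Longrightarrow> Rot b c f \<in> S"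
  and Mix_closed: "b \<in> Basis \<Longrightarrow> c \<in> Basis \<Longrightarrow> f \<in> S \<Longrightarrow> Mix b c f \<in> S"
  by (simp_all add: Xop_def Rot_def Mix_def closed)

lemma Xop_add: "A \<subseteq> Basis \<Longrightarrow> f \<in> S \<Longrightarrow> g \<in> S \<Longrightarrow> Xop A B (f + g) = Xop A B f + Xop A B g"
  by (simp add: Xop_def Lap_add algebra_simps)

lemma Xop_scale: "A \<subseteq> Basis \<Longrightarrow> f \<in> S \<Longrightarrow> Xop A B (cscale c f) = cscale c (Xop A B f)"
  by (simp add: Xop_def Lap_scale cscale_mult_right cfun.scale_right_distrib)

lemma Xop_diff: "A \<subseteq> Basis \<Longrightarrow> f \<in> S \<Longrightarrow> g \<in> S \<Longrightarrow> Xop A B (f - g) = Xop A B f - Xop A B g"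
  by (simp add: Xop_def Lap_diff algebra_simps)

lemma Rot_add: "f \<in> S \<Longrightarrow> g \<in> S \<Longrightarrow> Rot b c (f + g) = Rot b c f + Rot b c g"
  by (simp add: Rot_def d_add algebra_simps)

lemma Rot_diff: "f \<in> S \<Longrightarrow> g \<in> S \<Longrightarrow> Rot b c (f - g) = Rot b c f - Rot b c g"
  by (simp add: Rot_def d_diff algebra_simps)

lemma Rot_scale: "f \<in> S \<Longrightarrow> Rot b c (cscale a f) = cscale a (Rot b c f)"
  by (simp add: Rot_def d_scale cscale_mult_right cfun.scale_right_diff_distrib)

lemma Mix_add: "c \<in> Basis \<Longrightarrow> f \<in> S \<Longrightarrow> g \<in> S \<Longrightarrow> Mix b c (f + g) = Mix b c f + Mix b c g"
  by (simp add: Mix_def d_add dird_closed algebra_simps)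

lemma Mix_scale: "c \<in> Basis \<Longrightarrow> f \<in> S \<Longrightarrow> Mix b c (cscale a f) = cscale a (Mix b c f)"
  by (simp add: Mix_def d_scale dird_closed cscale_mult_right cfun.scale_right_distrib)

lemma Xop_bracket:
  assumes "A \<subseteq> Basis" "B \<subseteq> Basis" "A \<inter> B = {}" "f \<in> S"
  shows "Xop A B (Xop B A f) = Xop B A (Xop A B f)
    + cscale 4 (Eul A f - Eul B f) + cscale (2 * (of_nat (card A) - of_nat (card B))) f"
proof -
  have BA: "B \<inter> A = {}" using assms(3) by blast
  show ?thesis
    using assms(1,2,4)
    by (simp add: Xop_def Lap_add closed Lap_rsq Lap_rsq_disjoint[OF _ _ assms(3)]
        Lap_rsq_disjoint[OF _ _ BA] Lap_commute[of A B])
      (simp add: fun_eq_iff fun_apply cscale_def algebra_simps)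
qed

lemma Eul_Xop:
  assumes "A \<subseteq> Basis" "B \<subseteq> Basis" "A \<inter> B = {}" "f \<in> S"
  shows "Eul B (Xop A B f) - Eul A (Xop A B f)
    = Xop A B (Eul B f - Eul A f) + cscale 2 (Xop A B f)"
proof -
  have BA: "B \<inter> A = {}" using assms(3) by blast
  have empty: "Lap {} f = 0" "rsq ({} :: 'a set) = 0"
    by (simp_all add: Lap_def rsq_def)
  show ?thesis
    using assms(1,2,4)
    by (simp add: Xop_def Lap_diff Eul_add closed Eul_rsq Eul_Lap assms(3) BA empty)
      (simp add: fun_eq_iff fun_apply cscale_def algebra_simps)
qed

lemma Xop_Rot:
  assumes "A \<subseteq> Basis" "B \<subseteq> Basis" "b \<in> Basis" "c \<in> Basis" "f \<in> S"
    "b \<in> A \<longleftrightarrow> c \<in> A" "b \<in> B \<longleftrightarrow> c \<in> B"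
  shows "Xop A B (Rot b c f) = Rot b c (Xop A B f)"
  using assms
  by (simp add: Xop_def Rot_def Lap_diff Lap_coord Lap_d d_add d_rsq closed dird_commute[of b c])
    (auto simp: fun_eq_iff fun_apply algebra_simps)

lemma Xop_Mix:
  assumes "A \<subseteq> Basis" "B \<subseteq> Basis" "A \<inter> B = {}" "b \<in> A" "c \<in> B" "f \<in> S"
  shows "Xop A B (Mix b c f) = Mix b c (Xop A B f)"
    and "Xop B A (Mix b c f) = Mix b c (Xop B A f)"
proof -
  have bc: "b \<in> Basis" "c \<in> Basis" "b \<noteq> c" "c \<notin> A" "b \<notin> B" using assms by auto
  show "Xop A B (Mix b c f) = Mix b c (Xop A B f)"
    using assms bc
    by (simp add: Xop_def Mix_def Lap_add Lap_coord Lap_d d_add d_rsq d_two d_coord closed)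
      (auto simp: fun_eq_iff fun_apply algebra_simps)
  show "Xop B A (Mix b c f) = Mix b c (Xop B A f)"
    using assms bc
    by (simp add: Xop_def Mix_def Lap_add Lap_coord Lap_d d_add d_rsq d_two d_coord closed)
      (auto simp: fun_eq_iff fun_apply algebra_simps)
qed

lemma Eul_Rot:
  assumes "A \<subseteq> Basis" "b \<in> Basis" "c \<in> Basis" "f \<in> S" "b \<in> A \<longleftrightarrow> c \<in> A"
  shows "Eul A (Rot b c f) = Rot b c (Eul A f)"
  using assms
  by (simp add: Rot_def Eul_diff Eul_coord Eul_d closed)
    (auto simp: fun_eq_iff fun_apply algebra_simps)

lemma Eul_Mix:
  assumes "A \<subseteq> Basis" "B \<subseteq> Basis" "A \<inter> B = {}" "b \<in> A" "c \<in> B" "f \<in> S"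
  shows "Eul B (Mix b c f) - Eul A (Mix b c f) = Mix b c (Eul B f - Eul A f)"
proof -
  have bc: "b \<in> Basis" "c \<in> Basis" "c \<notin> A" "b \<notin> B" using assms by auto
  show ?thesis
    using assms bc
    by (simp add: Mix_def Eul_add Eul_coord Eul_d d_diff closed)
      (auto simp: fun_eq_iff fun_apply algebra_simps)
qed

end

section \<open>Highest weight vectors for sl2\<close>

text \<open>
  A space of functions with operators \<open>E\<close>, \<open>F\<close>, \<open>H\<close> that satisfy the relations of \<open>sl\<^sub>2\<close> on it. The
  operators are total functions, and nothing is known about them outside \<open>V\<close>.
\<close>

locale sl2_action =
  fixes V :: "('a \<Rightarrow> complex) set" and E F H :: "('a \<Rightarrow> complex) \<Rightarrow> 'a \<Rightarrow> complex"
  assumes subspace: "cfun.subspace V"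
    and E_closed: "f \<in> V \<Longrightarrow> E f \<in> V"
    and F_closed: "f \<in> V \<Longrightarrow> F f \<in> V"
    and H_closed: "f \<in> V \<Longrightarrow> H f \<in> V"
    and E_add: "f \<in> V \<Longrightarrow> g \<in> V \<Longrightarrow> E (f + g) = E f + E g"
    and F_add: "f \<in> V \<Longrightarrow> g \<in> V \<Longrightarrow> F (f + g) = F f + F g"
    and H_add: "f \<in> V \<Longrightarrow> g \<in> V \<Longrightarrow> H (f + g) = H f + H g"
    and E_scale: "f \<in> V \<Longrightarrow> E (cscale c f) = cscale c (E f)"
    and F_scale: "f \<in> V \<Longrightarrow> F (cscale c f) = cscale c (F f)"
    and H_scale: "f \<in> V \<Longrightarrow> H (cscale c f) = cscale c (H f)"
    and EF: "f \<in> V \<Longrightarrow> E (F f) = F (E f) + H f"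
    and HE: "f \<in> V \<Longrightarrow> H (E f) = E (H f) + cscale 2 (E f)"
    and HF: "f \<in> V \<Longrightarrow> H (F f) = F (H f) - cscale 2 (F f)"
begin

text \<open>
  The highest weight vectors of weight \<open>m\<close> that generate a representation of dimension \<open>m + 1\<close>,
  together with \<open>0\<close>.
\<close>

definition highest :: "nat \<Rightarrow> ('a \<Rightarrow> complex) set" where
  "highest m = {f \<in> V. H f = cscale (of_nat m) f \<and> E f = 0 \<and> (F ^^ (m + 1)) f = 0}"

lemma E_zero: "E 0 = 0" and F_zero: "F 0 = 0" and H_zero: "H 0 = 0"
  using E_scale[of 0 0] F_scale[of 0 0] H_scale[of 0 0] cfun.subspace_0[OF subspace] by auto

lemma V_zero: "0 \<in> V"
  by (rule cfun.subspace_0[OF subspace])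

lemma V_scale: "f \<in> V \<Longrightarrow> cscale c f \<in> V"
  by (rule cfun.subspace_scale[OF subspace])

text \<open>
  The automorphism of \<open>sl\<^sub>2\<close> that exchanges \<open>E\<close> and \<open>F\<close> turns lowest weight vectors into highest
  weight vectors.
\<close>

lemma swap: "sl2_action V F E (\<lambda>f. - H f)"
proof
  have neg: "- h = cscale (- 1) h" for h :: "'a \<Rightarrow> complex"
    by (simp add: cscale_def fun_eq_iff fun_apply)
  fix f g c
  assume f: "f \<in> V"
  show "- H f \<in> V" unfolding neg by (intro V_scale H_closed f)
  show "- H (cscale c f) = cscale c (- H f)" by (simp add: H_scale f)
  show "F (E f) = E (F f) + - H f" by (simp add: EF f)
  have "F (- H f) = - F (H f)" "E (- H f) = - E (H f)"
    unfolding neg by (simp_all only: F_scale E_scale H_closed f)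
  then show "- H (F f) = F (- H f) + cscale 2 (F f)" "- H (E f) = E (- H f) - cscale 2 (E f)"
    by (simp_all add: HF HE f)
  assume "g \<in> V"
  then show "- H (f + g) = - H f + - H g" by (simp add: H_add f)
qed (simp_all add: subspace E_closed F_closed E_add F_add E_scale F_scale)

lemma Fpow_closed: "f \<in> V \<Longrightarrow> (F ^^ j) f \<in> V"
  by (induction j) (simp_all add: F_closed)

lemma Fpow_add: "f \<in> V \<Longrightarrow> g \<in> V \<Longrightarrow> (F ^^ j) (f + g) = (F ^^ j) f + (F ^^ j) g"
  by (induction j) (simp_all add: F_add Fpow_closed)

lemma Fpow_scale: "f \<in> V \<Longrightarrow> (F ^^ j) (cscale c f) = cscale c ((F ^^ j) f)"
  by (induction j) (simp_all add: F_scale Fpow_closed)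

lemma Fpow_zero: "(F ^^ j) 0 = 0"
  by (induction j) (simp_all add: F_zero)

lemma subspace_highest: "cfun.subspace (highest m)"
proof (rule cfun.subspaceI)
  show "0 \<in> highest m" by (simp add: highest_def V_zero E_zero H_zero F_zero Fpow_zero)
  show "f + g \<in> highest m" if "f \<in> highest m" "g \<in> highest m" for f g
    using that cfun.subspace_add[OF subspace, of f g]
    by (simp add: highest_def E_add H_add F_add Fpow_add Fpow_closed cfun.scale_right_distrib)
  show "cscale c f \<in> highest m" if "f \<in> highest m" for c f
    using that
    by (simp add: highest_def V_scale E_scale H_scale F_scale Fpow_scale Fpow_closed mult.commute)
qed

lemma H_Fpow:
  assumes "f \<in> V" "H f = cscale (of_nat m) f"
  shows "H ((F ^^ j) f) = cscale (of_nat m - 2 * of_nat j) ((F ^^ j) f)"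
proof (induction j)
  case (Suc j)
  then show ?case
    by (simp add: HF F_scale Fpow_closed assms(1))
      (simp add: cscale_def fun_eq_iff fun_apply algebra_simps)
qed (use assms in simp)

lemma E_Fpow:
  assumes "f \<in> V" "H f = cscale (of_nat m) f" "E f = 0"
  shows "E ((F ^^ Suc j) f) = cscale (of_nat (Suc j) * (of_nat m - of_nat j)) ((F ^^ j) f)"
proof (induction j)
  case 0
  then show ?case using assms by (simp add: EF F_zero)
next
  case (Suc j)
  have "E ((F ^^ Suc (Suc j)) f) = F (E ((F ^^ Suc j) f)) + H ((F ^^ Suc j) f)"
    using EF[OF Fpow_closed[OF assms(1), of "Suc j"]] by simp
  also have "\<dots> = cscale (of_nat (Suc (Suc j)) * (of_nat m - of_nat (Suc j))) ((F ^^ Suc j) f)"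
    unfolding Suc H_Fpow[OF assms(1,2)]
    by (simp add: F_scale Fpow_closed assms(1))
      (simp add: cscale_def fun_eq_iff fun_apply algebra_simps)
  finally show ?case .
qed

lemma Epow_scale: "f \<in> V \<Longrightarrow> (E ^^ j) (cscale c f) = cscale c ((E ^^ j) f)"
  using sl2_action.Fpow_scale[OF swap] .

text \<open>The constant \<open>c\<close> depends on the weight only, and not on the vector \<open>f\<close>.\<close>

lemma Epow_Fpow:
  assumes "j \<le> k" "k \<le> m"
  shows "\<exists>c. c \<noteq> 0 \<and> (\<forall>f\<in>V. H f = cscale (of_nat m) f \<longrightarrow> E f = 0 \<longrightarrow>
    (E ^^ j) ((F ^^ k) f) = cscale c ((F ^^ (k - j)) f))"
  using assms
proof (induction j arbitrary: k)
  case 0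
  show ?case by (rule exI[of _ 1]) simp
next
  case (Suc j)
  then obtain i where k: "k = Suc i" using Suc_le_D by blast
  have "j \<le> i" "i \<le> m" using Suc.prems k by simp_all
  from Suc.IH[OF this] obtain c where c: "c \<noteq> 0" "\<And>f. f \<in> V \<Longrightarrow> H f = cscale (of_nat m) f \<Longrightarrow> E f = 0 \<Longrightarrow>
    (E ^^ j) ((F ^^ i) f) = cscale c ((F ^^ (i - j)) f)"
    by blast
  define d where "d = (of_nat (Suc i) * (of_nat m - of_nat i) :: complex)"
  have "(of_nat m :: complex) \<noteq> of_nat i" using Suc.prems k by simp
  then have "d \<noteq> 0" unfolding d_def by (simp del: of_nat_Suc)
  moreover have "(E ^^ Suc j) ((F ^^ k) f) = cscale (d * c) ((F ^^ (k - Suc j)) f)"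
    if "f \<in> V" "H f = cscale (of_nat m) f" "E f = 0" for f
    unfolding k funpow_Suc_right[of j E] o_def E_Fpow[OF that] d_def[symmetric]
    by (simp add: Epow_scale Fpow_closed that(1) c(2)[OF that])
  ultimately show ?case using c(1) by (intro exI[of _ "d * c"]) simp
qed

lemma Fpow_highest:
  assumes "f \<in> highest m"
  shows "(F ^^ m) f \<in> sl2_action.highest V F E (\<lambda>f. - H f) m"
proof -
  have f: "f \<in> V" "H f = cscale (of_nat m) f" "E f = 0" "F ((F ^^ m) f) = 0"
    using assms by (simp_all add: highest_def)
  obtain c where "(E ^^ m) ((F ^^ m) f) = cscale c f"
    using Epow_Fpow[of m m m] f by auto
  then have "E ((E ^^ m) ((F ^^ m) f)) = 0" using f by (simp add: E_scale)
  then show ?thesis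
    unfolding sl2_action.highest_def[OF swap]
    using f H_Fpow[OF f(1,2), of m] \<open>E ((E ^^ m) ((F ^^ m) f)) = 0\<close>
    by (simp add: Fpow_closed)
qed

lemma bij_betw_Fpow:
  "bij_betw (F ^^ m) (highest m) (sl2_action.highest V F E (\<lambda>f. - H f) m)"
proof -
  interpret swap: sl2_action V F E "\<lambda>f. - H f" by (rule swap)
  obtain c where c: "c \<noteq> 0" "\<And>f. f \<in> highest m \<Longrightarrow> (E ^^ m) ((F ^^ m) f) = cscale c f"
    using Epow_Fpow[of m m m] by (auto simp: highest_def)
  obtain d where d: "d \<noteq> 0" "\<And>f. f \<in> swap.highest m \<Longrightarrow> (F ^^ m) ((E ^^ m) f) = cscale d f"
    using swap.Epow_Fpow[of m m m] by (auto simp: swap.highest_def)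
  have E_high: "(E ^^ m) g \<in> highest m" if "g \<in> swap.highest m" for g
    using swap.Fpow_highest[OF that] by simp
  show ?thesis
    unfolding bij_betw_def
  proof
    show "inj_on (F ^^ m) (highest m)"
    proof (rule inj_onI)
      fix f g assume "f \<in> highest m" "g \<in> highest m" "(F ^^ m) f = (F ^^ m) g"
      then have "cscale c f = cscale c g" using c(2) by metis
      then show "f = g" using c(1) by auto
    qed
    have "g \<in> (F ^^ m) ` highest m" if g: "g \<in> swap.highest m" for g
    proof
      show "cscale (1 / d) ((E ^^ m) g) \<in> highest m"
        by (rule cfun.subspace_scale[OF subspace_highest E_high[OF g]])
      show "g = (F ^^ m) (cscale (1 / d) ((E ^^ m) g))"
        using d E_high[OF g] g by (simp add: Fpow_scale highest_def)
    qed
    then show "(F ^^ m) ` highest m = swap.highest m" using Fpow_highest by blast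
  qed
qed

lemma commuting_Fpow:
  assumes "\<And>f. f \<in> V \<Longrightarrow> F (P f) = P (F f)" "f \<in> V"
  shows "(F ^^ j) (P f) = P ((F ^^ j) f)"
  by (induction j) (simp_all add: assms Fpow_closed)

lemma commuting_highest:
  assumes "\<And>f. f \<in> V \<Longrightarrow> P f \<in> V" "\<And>f. f \<in> V \<Longrightarrow> E (P f) = P (E f)"
    "\<And>f. f \<in> V \<Longrightarrow> F (P f) = P (F f)" "\<And>f. f \<in> V \<Longrightarrow> H (P f) = P (H f)"
    "\<And>c f. f \<in> V \<Longrightarrow> P (cscale c f) = cscale c (P f)" "f \<in> highest m"
  shows "P f \<in> highest m"
proof -
  have P0: "P 0 = 0" using assms(5)[OF V_zero, of 0] by simp
  have f: "f \<in> V" using assms(6) by (simp add: highest_def)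
  show ?thesis
    using assms(6) f commuting_Fpow[of P f m, OF assms(3)]
    by (simp add: highest_def assms(1-5) Fpow_closed P0)
qed

text \<open>For \<open>f \<noteq> 0\<close> the conditions \<open>F\<^sup>j f \<noteq> 0\<close> are automatic, as \<open>E\<^sup>j F\<^sup>j f\<close> is a nonzero multiple of \<open>f\<close>.\<close>

lemma highest_eq:
  "{f. f = 0 \<or> (f \<in> V \<and> H f = cscale (of_nat m) f \<and> E f = 0
      \<and> (\<forall>j. 1 \<le> j \<and> j \<le> m \<longrightarrow> (F ^^ j) f \<noteq> 0) \<and> (F ^^ (m + 1)) f = 0)} = highest m"
proof -
  have "(F ^^ j) f \<noteq> 0"
    if f: "f \<in> V" "H f = cscale (of_nat m) f" "E f = 0" "f \<noteq> 0" and "j \<le> m" for f j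
  proof
    assume "(F ^^ j) f = 0"
    moreover obtain c where "c \<noteq> 0" "(E ^^ j) ((F ^^ j) f) = cscale c f"
      using Epow_Fpow[OF order_refl \<open>j \<le> m\<close>] f by auto
    ultimately show False
      using f(4) sl2_action.Fpow_zero[OF swap] by (metis cfun.scale_eq_0_iff)
  qed
  then show ?thesis
    unfolding highest_def by (auto simp: V_zero E_zero F_zero H_zero Fpow_zero)
qed

end

section \<open>Orthogonal changes of variables\<close>

lemma dird_compose_linear:
  fixes L :: "'a::euclidean_space \<Rightarrow> 'b::euclidean_space"
  assumes "linear L" "\<And>z. f differentiable (at z)"
  shows "dird v (\<lambda>z. f (L z)) = (\<lambda>z. dird (L v) f (L z))"
proof
  fix z
  have "(L has_derivative L) (at z)"
    using assms(1) by (simp add: linear_imp_has_derivative)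
  moreover have "(f has_derivative frechet_derivative f (at (L z))) (at (L z))"
    using assms(2) frechet_derivative_works by blast
  ultimately have "((\<lambda>z. f (L z)) has_derivative (\<lambda>v. frechet_derivative f (at (L z)) (L v))) (at z)"
    by (rule has_derivative_compose)
  then show "dird v (\<lambda>z. f (L z)) z = dird (L v) f (L z)"
    by (simp add: dird_eq dird_frechet assms(2))
qed

lemma dird_expand:
  fixes f :: "'a::euclidean_space \<Rightarrow> complex"
  assumes "\<And>z. f differentiable (at z)"
  shows "dird v f = (\<Sum>c\<in>Basis. cscale (of_real (v \<bullet> c)) (dird c f))"
proof
  fix z
  have lin: "linear (frechet_derivative f (at z))"
    using assms by (rule linear_frechet_derivative)
  have "dird v f z = frechet_derivative f (at z) (\<Sum>c\<in>Basis. (v \<bullet> c) *\<^sub>R c)"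
    by (simp add: dird_frechet assms euclidean_representation)
  also have "\<dots> = (\<Sum>c\<in>Basis. (v \<bullet> c) *\<^sub>R dird c f z)"
    by (simp add: dird_frechet assms linear_sum[OF lin] linear_scale[OF lin])
  finally show "dird v f z = (\<Sum>c\<in>Basis. cscale (of_real (v \<bullet> c)) (dird c f)) z"
    by (simp add: fun_sum_apply cscale_def scaleR_conv_of_real)
qed

text \<open>
  An orthogonal transformation that preserves the span of the coordinate vectors in \<open>A\<close> and the
  span of the remaining ones. It commutes with the operators attached to \<open>A\<close>.
\<close>

locale adapted_rotation =
  fixes L :: "'a::euclidean_space \<Rightarrow> 'a" and A :: "'a set"
  assumes orthogonal: "orthogonal_transformation L"
    and A_Basis: "A \<subseteq> Basis"
    and adapted: "b \<in> Basis \<Longrightarrow> c \<in> Basis \<Longrightarrow> (b \<in> A) \<noteq> (c \<in> A) \<Longrightarrow> L b \<bullet> c = 0"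
begin

lemma linear: "linear L"
  using orthogonal by (rule orthogonal_transformation_linear)

lemma finite_A: "finite A"
  using A_Basis finite_Basis finite_subset by blast

lemma sum_restrict:
  assumes "\<And>b. b \<in> Basis \<Longrightarrow> b \<notin> A \<Longrightarrow> F b = (0::real)"
  shows "(\<Sum>b\<in>A. F b) = (\<Sum>b\<in>Basis. F b)"
  using A_Basis assms by (intro sum.mono_neutral_left) auto

text \<open>
  The matrix entries of \<open>L\<close> between \<open>A\<close> and its complement vanish; hence the block that belongs to
  \<open>A\<close> is itself an orthogonal matrix.
\<close>

lemma columns:
  assumes "b \<in> Basis" "c \<in> Basis"
  shows "(\<Sum>e\<in>A. (L b \<bullet> e) * (L c \<bullet> e)) = (if b = c \<and> b \<in> A then 1 else 0)"
proof (cases "b \<in> A")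
  case True
  have "(\<Sum>e\<in>A. (L b \<bullet> e) * (L c \<bullet> e)) = L b \<bullet> L c"
    unfolding euclidean_inner[of "L b" "L c"]
    using True assms adapted by (intro sum_restrict) auto
  then show ?thesis
    using True assms orthogonal by (simp add: orthogonal_transformation_def inner_Basis)
next
  case False
  then show ?thesis using assms adapted A_Basis by (auto intro!: sum.neutral)
qed

lemma rows:
  assumes "c \<in> Basis" "e \<in> Basis"
  shows "(\<Sum>b\<in>A. (L b \<bullet> c) * (L b \<bullet> e)) = (if c = e \<and> c \<in> A then 1 else 0)"
proof (cases "c \<in> A")
  case True
  define M where "M = inv L"
  have M: "orthogonal_transformation M"
    using orthogonal unfolding M_def by (rule orthogonal_transformation_inv)
  have LM: "L (M z) = z" for z
    using orthogonal_transformation_surj[OF orthogonal] by (simp add: M_def surj_f_inv_f)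
  have adj: "L b \<bullet> z = b \<bullet> M z" for b z
    using orthogonal LM unfolding orthogonal_transformation_def by metis
  have "(\<Sum>b\<in>A. (L b \<bullet> c) * (L b \<bullet> e)) = (\<Sum>b\<in>Basis. (L b \<bullet> c) * (L b \<bullet> e))"
    using True assms adapted by (intro sum_restrict) auto
  also have "\<dots> = M c \<bullet> M e"
    unfolding euclidean_inner[of "M c" "M e"]
    by (intro sum.cong refl) (simp only: adj inner_commute[of "M c"] inner_commute[of "M e"])
  also have "\<dots> = c \<bullet> e"
    using M by (simp add: orthogonal_transformation_def)
  finally show ?thesis using True assms by (simp add: inner_Basis)
next
  case False
  then show ?thesis using assms adapted A_Basis by (auto intro!: sum.neutral)
qed

lemma coord_expand:
  assumes "c \<in> Basis"
  shows "(\<Sum>b\<in>A. (z \<bullet> b) * (L b \<bullet> c)) = (if c \<in> A then L z \<bullet> c else 0)"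
proof (cases "c \<in> A")
  case True
  have "(\<Sum>b\<in>A. (z \<bullet> b) * (L b \<bullet> c)) = (\<Sum>b\<in>Basis. (z \<bullet> b) * (L b \<bullet> c))"
    using True assms adapted by (intro sum_restrict) auto
  also have "\<dots> = L (\<Sum>b\<in>Basis. (z \<bullet> b) *\<^sub>R b) \<bullet> c"
    by (simp add: linear_sum[OF linear] linear_scale[OF linear] inner_sum_left)
  finally show ?thesis using True by (simp add: euclidean_representation)
next
  case False
  then show ?thesis using assms adapted A_Basis by (auto intro!: sum.neutral)
qed

lemma rsq_invariant: "rsq A (L z) = rsq A z"
proof -
  have "(\<Sum>c\<in>A. (L z \<bullet> c)\<^sup>2) = (\<Sum>c\<in>A. (\<Sum>b\<in>A. (z \<bullet> b) * (L b \<bullet> c)) * (\<Sum>b\<in>A. (z \<bullet> b) * (L b \<bullet> c)))"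
    using A_Basis by (intro sum.cong refl) (auto simp: coord_expand power2_eq_square)
  also have "\<dots> = (\<Sum>c\<in>A. \<Sum>b\<in>A. \<Sum>b'\<in>A. (z \<bullet> b) * (z \<bullet> b') * ((L b \<bullet> c) * (L b' \<bullet> c)))"
    unfolding sum_product by (intro sum.cong refl) (simp add: mult_ac)
  also have "\<dots> = (\<Sum>b\<in>A. \<Sum>c\<in>A. \<Sum>b'\<in>A. (z \<bullet> b) * (z \<bullet> b') * ((L b \<bullet> c) * (L b' \<bullet> c)))"
    by (rule sum.swap)
  also have "\<dots> = (\<Sum>b\<in>A. \<Sum>b'\<in>A. \<Sum>c\<in>A. (z \<bullet> b) * (z \<bullet> b') * ((L b \<bullet> c) * (L b' \<bullet> c)))"
    by (intro sum.cong refl sum.swap)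
  also have "\<dots> = (\<Sum>b\<in>A. \<Sum>b'\<in>A. if b = b' then (z \<bullet> b) * (z \<bullet> b') else 0)"
    unfolding sum_distrib_left[symmetric] using A_Basis
    by (intro sum.cong refl) (auto simp: columns subset_iff)
  also have "\<dots> = (\<Sum>b\<in>A. (z \<bullet> b)\<^sup>2)"
    by (simp add: finite_A power2_eq_square)
  finally have "complex_of_real (\<Sum>c\<in>A. (L z \<bullet> c)\<^sup>2) = complex_of_real (\<Sum>b\<in>A. (z \<bullet> b)\<^sup>2)"
    by simp
  then show ?thesis
    by (simp add: rsq_def fun_sum_apply fun_apply coord_def power2_eq_square)
qed

end

context diff_module
begin

lemma dird_any_closed: "f \<in> S \<Longrightarrow> dird v f \<in> S"
  by (subst dird_expand) (auto intro!: smooth sum_closed scale_closed dird_closed)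

lemma Lap_compose:
  assumes "adapted_rotation L A" "f \<in> S"
  shows "Lap A (\<lambda>z. f (L z)) = (\<lambda>z. Lap A f (L z))"
proof
  interpret adapted_rotation L A by fact
  fix z
  note fS = assms(2)
  have step: "dird b (dird b (\<lambda>z. f (L z))) z
      = (\<Sum>c\<in>Basis. \<Sum>e\<in>Basis. of_real ((L b \<bullet> c) * (L b \<bullet> e)) * dird c (dird e f) (L z))" for b
  proof -
    have "dird b (dird b (\<lambda>z. f (L z))) z = dird (L b) (dird (L b) f) (L z)"
      by (simp add: dird_compose_linear linear smooth dird_any_closed fS)
    also have "dird (L b) f = (\<Sum>e\<in>Basis. cscale (of_real (L b \<bullet> e)) (dird e f))"
      using fS smooth by (intro dird_expand)
    also have "dird (L b) \<dots> = (\<Sum>c\<in>Basis. cscale (of_real (L b \<bullet> c)) (dird c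
        (\<Sum>e\<in>Basis. cscale (of_real (L b \<bullet> e)) (dird e f))))"
      using fS by (intro dird_expand smooth sum_closed scale_closed dird_closed) auto
    also have "\<dots> = (\<Sum>c\<in>Basis. cscale (of_real (L b \<bullet> c))
        (\<Sum>e\<in>Basis. cscale (of_real (L b \<bullet> e)) (dird c (dird e f))))"
      using fS by (intro sum.cong refl) (simp add: d_sum d_scale closed)
    finally show ?thesis
      by (simp add: fun_sum_apply cscale_def sum_distrib_left mult.assoc)
  qed
  have "Lap A (\<lambda>z. f (L z)) z
      = (\<Sum>b\<in>A. \<Sum>c\<in>Basis. \<Sum>e\<in>Basis. of_real ((L b \<bullet> c) * (L b \<bullet> e)) * dird c (dird e f) (L z))"
    by (simp only: Lap_def fun_sum_apply step)
  also have "\<dots> = (\<Sum>c\<in>Basis. \<Sum>b\<in>A. \<Sum>e\<in>Basis. of_real ((L b \<bullet> c) * (L b \<bullet> e)) * dird c (dird e f) (L z))"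
    by (rule sum.swap)
  also have "\<dots> = (\<Sum>c\<in>Basis. \<Sum>e\<in>Basis. \<Sum>b\<in>A. of_real ((L b \<bullet> c) * (L b \<bullet> e)) * dird c (dird e f) (L z))"
    by (intro sum.cong refl sum.swap)
  also have "\<dots> = (\<Sum>c\<in>Basis. \<Sum>e\<in>Basis. if c = e then if c \<in> A then dird c (dird c f) (L z) else 0 else 0)"
    unfolding sum_distrib_right[symmetric] of_real_sum[symmetric]
    by (intro sum.cong refl) (auto simp: rows)
  also have "\<dots> = (\<Sum>c\<in>Basis. if c \<in> A then dird c (dird c f) (L z) else 0)"
    by simp
  also have "\<dots> = Lap A f (L z)"
    using A_Basis by (simp add: Lap_def fun_sum_apply Int_absorb1 flip: sum.inter_restrict)
  finally show "Lap A (\<lambda>z. f (L z)) z = Lap A f (L z)" .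
qed

lemma Eul_compose:
  assumes "adapted_rotation L A" "f \<in> S"
  shows "Eul A (\<lambda>z. f (L z)) = (\<lambda>z. Eul A f (L z))"
proof
  interpret adapted_rotation L A by fact
  fix z
  have "Eul A (\<lambda>z. f (L z)) z
      = (\<Sum>b\<in>A. \<Sum>c\<in>Basis. of_real ((z \<bullet> b) * (L b \<bullet> c)) * dird c f (L z))"
    unfolding Eul_def fun_sum_apply fun_apply
    by (intro sum.cong refl, subst dird_compose_linear[OF linear smooth[OF assms(2)]],
        subst dird_expand[OF smooth[OF assms(2)]])
      (simp add: fun_sum_apply cscale_def coord_def sum_distrib_left mult.assoc)
  also have "\<dots> = (\<Sum>c\<in>Basis. \<Sum>b\<in>A. of_real ((z \<bullet> b) * (L b \<bullet> c)) * dird c f (L z))"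
    by (rule sum.swap)
  also have "\<dots> = (\<Sum>c\<in>Basis. if c \<in> A then of_real (L z \<bullet> c) * dird c f (L z) else 0)"
    unfolding sum_distrib_right[symmetric] of_real_sum[symmetric]
    by (intro sum.cong refl) (auto simp: coord_expand)
  also have "\<dots> = Eul A f (L z)"
    using A_Basis
    by (simp add: Eul_def fun_sum_apply fun_apply coord_def Int_absorb1 flip: sum.inter_restrict)
  finally show "Eul A (\<lambda>z. f (L z)) z = Eul A f (L z)" .
qed

lemma Xop_compose:
  assumes "adapted_rotation L A" "adapted_rotation L B" "f \<in> S"
  shows "Xop A B (\<lambda>z. f (L z)) = (\<lambda>z. Xop A B f (L z))"
  unfolding Xop_def Lap_compose[OF assms(1,3)]
  by (simp add: fun_eq_iff fun_apply adapted_rotation.rsq_invariant[OF assms(2)])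

end

lemma polymod_compose_linear:
  fixes L :: "'a::euclidean_space \<Rightarrow> 'a"
  assumes "linear L" "\<And>g. g \<in> G \<Longrightarrow> (\<lambda>z. g (L z)) = g" "f \<in> polymod G"
  shows "(\<lambda>z. f (L z)) \<in> polymod G"
  using assms(3)
proof (induction rule: polymod.induct)
  case (gen g)
  then show ?case by (simp add: assms(2) polymod.gen)
next
  case zero
  then show ?case using polymod.zero by (simp add: zero_fun_def)
next
  case (add f g)
  then show ?case using polymod.add by (fastforce simp: plus_fun_def)
next
  case (scale f c)
  then show ?case using polymod.scale by (fastforce simp: cscale_def)
next
  case (coord b f)
  have "bounded_linear L" using assms(1) by (simp add: linear_conv_bounded_linear)
  then have "(\<lambda>z. coord b (L z)) \<in> polys"
    by (rule poly_compose[OF coord_poly[OF coord.hyps(1)]])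
  from poly_mult_closed[OF this coord.IH] show ?case by (simp add: times_fun_def)
qed

section \<open>Coordinates on the product space\<close>

text \<open>
  The coordinate vectors of \<open>\<real>\<^sup>p\<close> and of \<open>\<real>\<^sup>q\<close> in \<open>\<real>\<^sup>p \<times> \<real>\<^sup>q\<close>; \<open>xbasis\<close> and \<open>ybasis\<close> play the roles of
  \<open>A\<close> and \<open>B\<close> above.
\<close>

definition xvec :: "'p::finite \<Rightarrow> (real^'p) \<times> (real^'q::finite)" where
  "xvec i = (axis i 1, 0)"

definition yvec :: "'q::finite \<Rightarrow> (real^'p::finite) \<times> (real^'q)" where
  "yvec j = (0, axis j 1)"

abbreviation xbasis :: "((real^'p::finite) \<times> (real^'q::finite)) set" where
  "xbasis \<equiv> range xvec"

abbreviation ybasis :: "((real^'p::finite) \<times> (real^'q::finite)) set" where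
  "ybasis \<equiv> range yvec"

lemma range_axis: "range (\<lambda>i. axis i 1 :: real^'n::finite) = Basis"
  by (auto simp: Basis_vec_def)

lemma xbasis_image: "xbasis = (\<lambda>b. (b, 0)) ` Basis"
  unfolding range_axis[symmetric] image_image xvec_def ..

lemma ybasis_image: "ybasis = (\<lambda>b. (0, b)) ` Basis"
  unfolding range_axis[symmetric] image_image yvec_def ..

lemma Basis_xy: "(Basis :: ((real^'p::finite) \<times> (real^'q::finite)) set) = xbasis \<union> ybasis"
  unfolding Basis_prod_def xbasis_image ybasis_image ..

lemma xbasis_subset: "xbasis \<subseteq> Basis" and ybasis_subset: "ybasis \<subseteq> Basis"
  by (auto simp: Basis_xy)

lemma xvec_Basis: "xvec i \<in> Basis" and yvec_Basis: "yvec i \<in> Basis"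
  by (auto simp: Basis_xy)

lemma xbasis_ybasis_disjoint: "xbasis \<inter> ybasis = {}"
  by (auto simp: xvec_def yvec_def axis_eq_0_iff)

lemma inj_xvec: "inj xvec" and inj_yvec: "inj yvec"
  by (auto simp: inj_def xvec_def yvec_def axis_eq_axis)

lemma card_xbasis: "card (xbasis :: ((real^'p::finite) \<times> (real^'q::finite)) set) = CARD('p)"
  and card_ybasis: "card (ybasis :: ((real^'p::finite) \<times> (real^'q::finite)) set) = CARD('q)"
  by (simp_all add: card_image inj_xvec inj_yvec)

lemma cx_eq: "cx i = coord (xvec i)" and cy_eq: "cy j = coord (yvec j)"
  by (auto simp: cx_def cy_def coord_def xvec_def yvec_def inner_axis)

lemma dx_eq: "dx i = dird (xvec i)" and dy_eq: "dy j = dird (yvec j)"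
  by (simp_all add: dx_def dy_def xvec_def yvec_def)

lemma Lapx_eq: "Lapx f = Lap xbasis f" and Lapy_eq: "Lapy f = Lap ybasis f"
  by (simp_all add: fun_eq_iff Lapx_def Lapy_def Lap_def dx_eq dy_eq fun_sum_apply
      sum.reindex inj_xvec inj_yvec)

lemma Ex_eq: "Ex f = Eul xbasis f" and Ey_eq: "Ey f = Eul ybasis f"
  by (simp_all add: fun_eq_iff Ex_def Ey_def Eul_def dx_eq dy_eq cx_eq cy_eq fun_sum_apply
      fun_apply sum.reindex inj_xvec inj_yvec)

lemma r2x_eq: "r2x = rsq xbasis" and r2y_eq: "r2y = rsq ybasis"
  by (simp_all add: fun_eq_iff r2x_def r2y_def rsq_def cx_eq cy_eq fun_sum_apply
      fun_apply sum.reindex inj_xvec inj_yvec power2_eq_square)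

lemma opXplus_eq: "opXplus f = cscale (- 1 / 2) (Xop xbasis ybasis f)"
  and opXminus_eq: "opXminus f = cscale (1 / 2) (Xop ybasis xbasis f)"
  by (simp_all add: fun_eq_iff opXplus_def opXminus_def Xop_def Lapx_eq Lapy_eq r2x_eq r2y_eq
      cscale_def fun_apply add.commute)

lemma opH_eq:
  "opH f = Eul ybasis f - Eul xbasis f + cscale ((of_nat CARD('q) - of_nat CARD('p)) / 2) f"
  for f :: "('p::finite, 'q::finite) vfun"
  by (simp add: fun_eq_iff opH_def Ex_eq Ey_eq cscale_def fun_apply algebra_simps diff_divide_distrib)

lemma piP_eq: "piP i j f = Rot (xvec i) (xvec j) f"
  and piQ_eq: "piQ k l f = Rot (yvec k) (yvec l) f"
  and piM_eq: "piM i k f = cscale \<i> (Mix (xvec i) (yvec k) f)"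
  by (simp_all add: fun_eq_iff piP_def piQ_def piM_def Rot_def Mix_def cx_eq cy_eq dx_eq dy_eq
      cscale_def fun_apply mult.assoc)

lemma pi_act_eq:
  "pi_act X f =
      (\<Sum>i\<in>UNIV. \<Sum>j\<in>UNIV. cscale (X $ Inl i $ Inl j / 2) (Rot (xvec i) (xvec j) f))
    + (\<Sum>i\<in>UNIV. \<Sum>j\<in>UNIV. cscale (X $ Inr i $ Inr j / 2) (Rot (yvec i) (yvec j) f))
    + (\<Sum>i\<in>UNIV. \<Sum>j\<in>UNIV. cscale (X $ Inl i $ Inr j * \<i>) (Mix (xvec i) (yvec j) f))"
  by (simp add: fun_eq_iff pi_act_def piP_eq piQ_eq piM_eq fun_apply fun_sum_apply cscale_def
      sum_divide_distrib mult.assoc)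

section \<open>The space E as a module over the polynomials\<close>

text \<open>The argument \<open>\<rho>\<^sub>x \<rho>\<^sub>y\<close> of the functions \<open>psi \<alpha>\<close>.\<close>

definition psi_arg :: "('p::finite, 'q::finite) vfun" where
  "psi_arg = (\<lambda>z. rhox z * rhoy z)"

lemma rhox_eq: "rhox = cscale (1 / 2) (rsq xbasis)" and rhoy_eq: "rhoy = cscale (1 / 2) (rsq ybasis)"
  by (simp_all add: rhox_def rhoy_def r2x_eq r2y_eq cscale_def fun_eq_iff)

lemma rhox_poly: "rhox \<in> polys" and rhoy_poly: "rhoy \<in> polys"
  by (simp_all add: rhox_eq rhoy_eq polymod.scale rsq_poly xbasis_subset ybasis_subset)

lemma psi_arg_poly: "psi_arg \<in> polys"
  using poly_mult_closed[OF rhox_poly rhoy_poly] by (simp add: psi_arg_def times_fun_def)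

lemma psi_eq: "psi \<alpha> = (\<lambda>z. Psi \<alpha> (psi_arg z))"
  by (simp add: psi_def psi_arg_def)

text \<open>The generators of \<open>Espace\<close> over the polynomials.\<close>

abbreviation psis :: "('p::finite, 'q::finite) vfun set" where
  "psis \<equiv> {psi \<alpha> | \<alpha>. \<alpha> \<notin> \<int>\<^sub>\<le>\<^sub>0}"

lemma psis_eq: "psis = {\<lambda>z. Psi \<alpha> (psi_arg z) | \<alpha>. \<alpha> \<notin> \<int>\<^sub>\<le>\<^sub>0}"
  by (simp add: psi_eq)

lemma harm_polys: "h \<in> harm k \<Longrightarrow> h \<in> polys"
  by (rule polynomial_function_polys) (simp add: harm_def)

lemma hpoly_harm:
  fixes h :: "real^'n::finite \<Rightarrow> complex"
  assumes "hpoly k h" "Lap Basis h = 0"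
  shows "h \<in> harm k"
proof -
  have "(\<Sum>i\<in>UNIV. dird (axis i 1) (dird (axis i 1) h) x) = Lap Basis h x" for x
    unfolding Lap_def range_axis[symmetric] fun_sum_apply
    by (subst sum.reindex) (auto simp: inj_def axis_eq_axis)
  then show ?thesis
    using assms hpoly_polynomial_function hpoly_homogeneous[OF assms(1)]
    by (auto simp: harm_def fun_apply)
qed

lemma power_fun_apply: "(f ^ n) z = f z ^ n" for f :: "'a \<Rightarrow> complex"
  by (induction n) (simp_all add: fun_apply)

lemma rsq_fst: "rsq Basis (fst z) = 2 * rhox z" and rsq_snd: "rsq Basis (snd z) = 2 * rhoy z"
proof -
  have "rsq xbasis z = rsq Basis (fst z)" "rsq ybasis z = rsq Basis (snd z)"
    unfolding xbasis_image ybasis_image rsq_def fun_sum_apply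
    by (subst sum.reindex; auto simp: inj_on_def fun_apply coord_def inner_prod_def)+
  then show "rsq Basis (fst z) = 2 * rhox z" "rsq Basis (snd z) = 2 * rhoy z"
    by (simp_all add: rhox_eq rhoy_eq cscale_def)
qed

lemma Espace_gen:
  "h1 \<in> harm k \<Longrightarrow> h2 \<in> harm l \<Longrightarrow> \<alpha> \<notin> \<int>\<^sub>\<le>\<^sub>0 \<Longrightarrow>
    (\<lambda>z. h1 (fst z) * h2 (snd z) * rhox z ^ a * rhoy z ^ b * psi \<alpha> z) \<in> Espace"
  unfolding Espace_def by (rule cfun.span_base) blast

lemma subspace_Espace: "cfun.subspace Espace"
  by (simp add: Espace_def)

lemma span_compose:
  fixes u :: "'b \<Rightarrow> complex" and L :: "'b \<Rightarrow> 'a"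
  assumes "f \<in> cfun.span X" "cfun.subspace T" "\<And>g. g \<in> X \<Longrightarrow> (\<lambda>z. g (L z) * u z) \<in> T"
  shows "(\<lambda>z. f (L z) * u z) \<in> T"
proof -
  have "cfun.subspace {f. (\<lambda>z. f (L z) * u z) \<in> T}"
    using cfun.subspace_0[OF assms(2)] cfun.subspace_add[OF assms(2)]
      cfun.subspace_scale[OF assms(2)]
    by (auto simp: cfun.subspace_def fun_apply distrib_right zero_fun_def plus_fun_def
        cscale_def mult.assoc)
  then show ?thesis
    using cfun.span_minimal[of X "{f. (\<lambda>z. f (L z) * u z) \<in> T}"] assms(1,3) by blast
qed

text \<open>
  By the Fischer decomposition, an arbitrary polynomial in \<open>x\<close> may replace the factor
  \<open>h\<^sub>1 \<rho>\<^sub>x\<^sup>a\<close> of a spanning element of \<open>Espace\<close>; similarly for \<open>y\<close>.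
\<close>

lemma poly_x_Espace:
  fixes f :: "real^'p::finite \<Rightarrow> complex" and h2 :: "real^'q::finite \<Rightarrow> complex"
  assumes "f \<in> polys" "h2 \<in> harm l" "\<alpha> \<notin> \<int>\<^sub>\<le>\<^sub>0"
  shows "(\<lambda>z. f (fst z) * (h2 (snd z) * rhoy z ^ b * psi \<alpha> z)) \<in> Espace"
proof (rule span_compose[OF polys_span_fischer_gens[OF assms(1)] subspace_Espace])
  fix g :: "real^'p \<Rightarrow> complex" assume "g \<in> fischer_gens"
  then obtain a h k where g: "g = rsq Basis ^ a * h" and h: "h \<in> harm k"
    by (auto simp: fischer_gens_def dest: hpoly_harm)
  have "(\<lambda>z. g (fst z) * (h2 (snd z) * rhoy z ^ b * psi \<alpha> z))
      = cscale (2 ^ a) (\<lambda>z. h (fst z) * h2 (snd z) * rhox z ^ a * rhoy z ^ b * psi \<alpha> z)"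
    by (simp add: g fun_eq_iff fun_apply power_fun_apply rsq_fst cscale_def power_mult_distrib mult_ac)
  then show "(\<lambda>z. g (fst z) * (h2 (snd z) * rhoy z ^ b * psi \<alpha> z)) \<in> Espace"
    using cfun.subspace_scale[OF subspace_Espace Espace_gen[OF h assms(2,3)]] by simp
qed

lemma poly_y_Espace:
  fixes f :: "real^'q::finite \<Rightarrow> complex" and h1 :: "real^'p::finite \<Rightarrow> complex"
  assumes "f \<in> polys" "h1 \<in> harm k" "\<alpha> \<notin> \<int>\<^sub>\<le>\<^sub>0"
  shows "(\<lambda>z. f (snd z) * (h1 (fst z) * rhox z ^ a * psi \<alpha> z)) \<in> Espace"
proof (rule span_compose[OF polys_span_fischer_gens[OF assms(1)] subspace_Espace])
  fix g :: "real^'q \<Rightarrow> complex" assume "g \<in> fischer_gens"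
  then obtain b h l where g: "g = rsq Basis ^ b * h" and h: "h \<in> harm l"
    by (auto simp: fischer_gens_def dest: hpoly_harm)
  have "(\<lambda>z. g (snd z) * (h1 (fst z) * rhox z ^ a * psi \<alpha> z))
      = cscale (2 ^ b) (\<lambda>z. h1 (fst z) * h (snd z) * rhox z ^ a * rhoy z ^ b * psi \<alpha> z)"
    by (simp add: g fun_eq_iff fun_apply power_fun_apply rsq_snd cscale_def power_mult_distrib mult_ac)
  then show "(\<lambda>z. g (snd z) * (h1 (fst z) * rhox z ^ a * psi \<alpha> z)) \<in> Espace"
    using cfun.subspace_scale[OF subspace_Espace Espace_gen[OF assms(2) h assms(3)]] by simp
qed

lemma coord_Espace:
  fixes f :: "('p::finite, 'q::finite) vfun"
  assumes "b \<in> Basis" "f \<in> Espace"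
  shows "coord b * f \<in> Espace"
proof (rule mult_span_closed[OF assms(2)[unfolded Espace_def] subspace_Espace])
  fix g :: "('p, 'q) vfun"
  assume "g \<in> {\<lambda>z. h1 (fst z) * h2 (snd z) * rhox z ^ a * rhoy z ^ b * psi \<alpha> z | h1 h2 k l a b \<alpha>.
        h1 \<in> harm k \<and> h2 \<in> harm l \<and> \<alpha> \<notin> \<int>\<^sub>\<le>\<^sub>0}"
  then obtain h1 h2 k l m n \<alpha> where
    g: "g = (\<lambda>z. h1 (fst z) * h2 (snd z) * rhox z ^ m * rhoy z ^ n * psi \<alpha> z)"
    and h: "h1 \<in> harm k" "h2 \<in> harm l" and \<alpha>: "\<alpha> \<notin> \<int>\<^sub>\<le>\<^sub>0" by blast
  consider c where "c \<in> Basis" "b = (c, 0)" | c where "c \<in> Basis" "b = (0, c)"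
    using assms(1) by (auto simp: Basis_prod_def)
  then show "coord b * g \<in> Espace"
  proof cases
    case 1
    have "coord c * (h1 * cscale (1 / 2) (rsq Basis) ^ m) \<in> polys"
      using 1 h by (intro polymod.coord poly_mult_closed power_poly polymod.scale rsq_poly harm_polys) auto
    from poly_x_Espace[OF this h(2) \<alpha>, of n] show ?thesis
      by (simp add: g 1 times_fun_def power_fun_apply cscale_def rsq_fst coord_def
          inner_prod_def mult_ac)
  next
    case 2
    have "coord c * (h2 * cscale (1 / 2) (rsq Basis) ^ n) \<in> polys"
      using 2 h by (intro polymod.coord poly_mult_closed power_poly polymod.scale rsq_poly harm_polys) auto
    from poly_y_Espace[OF this h(1) \<alpha>, of m] show ?thesis
      by (simp add: g 2 times_fun_def power_fun_apply cscale_def rsq_snd coord_def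
          inner_prod_def mult_ac)
  qed
qed

lemma one_harm: "(\<lambda>x. 1) \<in> harm 0"
  unfolding one_fun_def[symmetric]
  by (rule hpoly_harm[OF hpoly.one]) (simp add: Lap_hpoly[OF hpoly.one order_refl])

text \<open>
  The coefficients of the functions \<open>psi \<alpha>\<close> may be arbitrary polynomials, and not only products of
  harmonic polynomials and powers of \<open>\<rho>\<^sub>x\<close> and \<open>\<rho>\<^sub>y\<close>. In this form the stability under partial
  derivatives is apparent.
\<close>

lemma Espace_eq: "(Espace :: ('p::finite, 'q::finite) vfun set) = polymod psis"
proof
  show "(Espace :: ('p, 'q) vfun set) \<subseteq> polymod psis"
    unfolding Espace_def
  proof (rule cfun.span_minimal[OF _ subspace_polymod], safe)
    fix h1 :: "real^'p \<Rightarrow> complex" and h2 :: "real^'q \<Rightarrow> complex" and k l a b and \<alpha> :: complex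
    assume h: "h1 \<in> harm k" "h2 \<in> harm l" and \<alpha>: "\<alpha> \<notin> \<int>\<^sub>\<le>\<^sub>0"
    have "psi \<alpha> \<in> polymod psis" using \<alpha> by (auto intro: polymod.gen)
    then have "(\<lambda>z. h1 (fst z)) * ((\<lambda>z. h2 (snd z)) * (rhox ^ a * (rhoy ^ b * psi \<alpha>))) \<in> polymod psis"
      by (intro poly_mult_closed power_poly rhox_poly rhoy_poly
          poly_compose[OF harm_polys[OF h(1)] bounded_linear_fst]
          poly_compose[OF harm_polys[OF h(2)] bounded_linear_snd])
    then show "(\<lambda>z. h1 (fst z) * h2 (snd z) * rhox z ^ a * rhoy z ^ b * psi \<alpha> z) \<in> polymod psis"
      by (simp add: times_fun_def power_fun_apply mult.assoc)
  qed
  show "polymod psis \<subseteq> (Espace :: ('p, 'q) vfun set)"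
  proof
    fix f :: "('p, 'q) vfun" assume "f \<in> polymod psis"
    then show "f \<in> Espace"
    proof (induction rule: polymod.induct)
      case (gen g)
      then obtain \<alpha> where "g = psi \<alpha>" "\<alpha> \<notin> \<int>\<^sub>\<le>\<^sub>0" by blast
      then show ?case using Espace_gen[OF one_harm one_harm, of \<alpha> 0 0] by simp
    qed (auto intro: coord_Espace cfun.subspace_0[OF subspace_Espace]
        cfun.subspace_add[OF subspace_Espace] cfun.subspace_scale[OF subspace_Espace])
  qed
qed

global_interpretation Esp: diff_module "Espace :: ('p::finite, 'q::finite) vfun set"
  unfolding Espace_eq psis_eq by (rule diff_module_Psi[OF psi_arg_poly])

lemma xbasis_not_ybasis: "xvec i \<notin> ybasis" and ybasis_not_xbasis: "yvec j \<notin> xbasis"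
  using xbasis_ybasis_disjoint by auto

lemma ybasis_xbasis_disjoint: "ybasis \<inter> xbasis = {}"
  using xbasis_ybasis_disjoint by blast

lemmas basis_facts = xbasis_subset ybasis_subset xbasis_ybasis_disjoint ybasis_xbasis_disjoint xvec_Basis yvec_Basis

section \<open>The triple of operators and the two actions\<close>

global_interpretation sl2: sl2_action "Espace :: ('p::finite, 'q::finite) vfun set" opXplus opXminus opH
proof
  fix f g :: "('p, 'q) vfun" and c
  assume f: "f \<in> Espace"
  show "opXplus f \<in> Espace" "opXminus f \<in> Espace" "opH f \<in> Espace"
    using f by (simp_all add: opXplus_eq opXminus_eq opH_eq Esp.closed Esp.Xop_closed basis_facts)
  show "opXplus (cscale c f) = cscale c (opXplus f)" "opXminus (cscale c f) = cscale c (opXminus f)"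
    using f by (simp_all add: opXplus_eq opXminus_eq Esp.Xop_scale basis_facts mult.commute)
  show "opH (cscale c f) = cscale c (opH f)"
    using f by (simp add: opH_eq Esp.Eul_scale basis_facts)
      (simp add: cscale_def fun_eq_iff fun_apply algebra_simps)
  \<comment> \<open>The factor \<open>- 1 / 2\<close> of \<open>opXplus\<close> has to remain a scalar for linearity to apply, whence
    the deletion of \<open>scale_minus_left\<close> here and below.\<close>
  show "opXplus (opXminus f) = opXminus (opXplus f) + opH f"
    using f Esp.Xop_bracket[OF xbasis_subset ybasis_subset xbasis_ybasis_disjoint f]
    by (simp add: opXplus_eq opXminus_eq opH_eq Esp.Xop_scale Esp.Xop_closed basis_facts
        card_xbasis card_ybasis del: cfun.scale_minus_left)
      (simp add: cscale_def fun_eq_iff fun_apply field_simps)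
  have "Xop xbasis ybasis (Eul ybasis f) = Eul ybasis (Xop xbasis ybasis f) - Eul xbasis (Xop xbasis ybasis f)
      + Xop xbasis ybasis (Eul xbasis f) - cscale 2 (Xop xbasis ybasis f)"
    using Esp.Eul_Xop[OF xbasis_subset ybasis_subset xbasis_ybasis_disjoint f] f
    by (simp add: Esp.Xop_diff Esp.closed basis_facts algebra_simps)
  then show "opH (opXplus f) = opXplus (opH f) + cscale 2 (opXplus f)"
    using f
    by (simp add: opXplus_eq opH_eq Esp.Xop_scale Esp.Xop_add Esp.Xop_diff Esp.Xop_closed
        basis_facts Esp.Eul_scale Esp.closed del: cfun.scale_minus_left)
      (simp add: cscale_def fun_eq_iff fun_apply field_simps)
  have "Xop ybasis xbasis (Eul xbasis f) = Eul xbasis (Xop ybasis xbasis f) - Eul ybasis (Xop ybasis xbasis f)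
      + Xop ybasis xbasis (Eul ybasis f) - cscale 2 (Xop ybasis xbasis f)"
    using Esp.Eul_Xop[OF ybasis_subset xbasis_subset ybasis_xbasis_disjoint f] f
    by (simp add: Esp.Xop_diff Esp.closed basis_facts algebra_simps)
  then show "opH (opXminus f) = opXminus (opH f) - cscale 2 (opXminus f)"
    using f
    by (simp add: opXminus_eq opH_eq Esp.Xop_scale Esp.Xop_add Esp.Xop_diff Esp.Xop_closed
        basis_facts Esp.Eul_scale Esp.closed)
      (simp add: cscale_def fun_eq_iff fun_apply field_simps)
  assume g: "g \<in> Espace"
  show "opXplus (f + g) = opXplus f + opXplus g" "opXminus (f + g) = opXminus f + opXminus g"
    using f g by (simp_all add: opXplus_eq opXminus_eq Esp.Xop_add basis_facts cfun.scale_right_distrib)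
  show "opH (f + g) = opH f + opH g"
    using f g by (simp add: opH_eq Esp.Eul_add basis_facts cfun.scale_right_distrib)
qed (rule subspace_Espace)

lemma pi_act_closed: "f \<in> Espace \<Longrightarrow> pi_act X f \<in> Espace"
  unfolding pi_act_eq
  by (intro Esp.add_closed Esp.sum_closed Esp.scale_closed Esp.Rot_closed Esp.Mix_closed xvec_Basis yvec_Basis)

text \<open>
  A linear operator commutes with the Lie algebra if it commutes with the operators by which a
  spanning set acts.
\<close>

lemma commutes_pi_act:
  fixes T :: "('p::finite, 'q::finite) vfun \<Rightarrow> ('p, 'q) vfun"
  assumes f: "f \<in> Espace"
    and add: "\<And>g h. g \<in> Espace \<Longrightarrow> h \<in> Espace \<Longrightarrow> T (g + h) = T g + T h"
    and scale: "\<And>c g. g \<in> Espace \<Longrightarrow> T (cscale c g) = cscale c (T g)"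
    and x: "\<And>i j. T (Rot (xvec i) (xvec j) f) = Rot (xvec i) (xvec j) (T f)"
    and y: "\<And>i j. T (Rot (yvec i) (yvec j) f) = Rot (yvec i) (yvec j) (T f)"
    and xy: "\<And>i j. T (Mix (xvec i) (yvec j) f) = Mix (xvec i) (yvec j) (T f)"
  shows "T (pi_act X f) = pi_act X (T f)"
proof -
  have "T (0::('p, 'q) vfun) = 0"
    using scale[OF Esp.zero_closed, of 0] by simp
  then have sum: "T (\<Sum>i\<in>I. F i) = (\<Sum>i\<in>I. T (F i))"
    if "\<And>i. F i \<in> Espace" for I :: "'i set" and F
    using that by (induction I rule: infinite_finite_induct) (simp_all add: add Esp.sum_closed)
  note c = Esp.scale_closed Esp.Rot_closed Esp.Mix_closed xvec_Basis yvec_Basis Esp.sum_closed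
    Esp.add_closed f
  show ?thesis
    unfolding pi_act_eq by (simp add: add sum scale x y xy c)
qed

lemma pi_act_opXplus:
  assumes f: "f \<in> Espace"
  shows "opXplus (pi_act X f) = pi_act X (opXplus f)"
proof (rule commutes_pi_act[OF f sl2.E_add sl2.E_scale])
qed (use f in \<open>simp_all add: opXplus_eq Esp.Rot_scale Esp.Mix_scale Esp.Xop_closed basis_facts
      Esp.Xop_Rot Esp.Xop_Mix xbasis_not_ybasis ybasis_not_xbasis del: cfun.scale_minus_left\<close>)

lemma pi_act_opXminus:
  assumes f: "f \<in> Espace"
  shows "opXminus (pi_act X f) = pi_act X (opXminus f)"
proof (rule commutes_pi_act[OF f sl2.F_add sl2.F_scale])
qed (use f in \<open>simp_all add: opXminus_eq Esp.Rot_scale Esp.Mix_scale Esp.Xop_closed basis_facts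
      Esp.Xop_Rot Esp.Xop_Mix xbasis_not_ybasis ybasis_not_xbasis\<close>)

lemma pi_act_opH:
  assumes f: "f \<in> Espace"
  shows "opH (pi_act X f) = pi_act X (opH f)"
proof (rule commutes_pi_act[OF f sl2.H_add sl2.H_scale])
  show "opH (Mix (xvec i) (yvec j) f) = Mix (xvec i) (yvec j) (opH f)" for i j
    using f Esp.Eul_Mix[OF xbasis_subset ybasis_subset xbasis_ybasis_disjoint _ _ f, of "xvec i" "yvec j"]
    by (simp add: opH_eq Esp.Mix_add Esp.Mix_scale Esp.closed basis_facts)
qed (use f in \<open>simp_all add: opH_eq Esp.Rot_add Esp.Rot_scale Esp.Rot_diff Esp.closed basis_facts
      Esp.Eul_Rot xbasis_not_ybasis ybasis_not_xbasis\<close>)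

lemma pi_act_scale: "f \<in> Espace \<Longrightarrow> pi_act X (cscale c f) = cscale c (pi_act X f)"
  unfolding pi_act_eq
  by (simp add: Esp.Rot_scale Esp.Mix_scale yvec_Basis cfun.scale_right_distrib
      cfun.scale_sum_right mult.commute)

text \<open>The linear map by which \<open>k\<close> acts on arguments.\<close>

definition K_map :: "(real^'p^'p) \<times> (real^'q^'q) \<Rightarrow> (real^'p::finite) \<times> (real^'q::finite) \<Rightarrow> (real^'p) \<times> (real^'q)" where
  "K_map k z = (matrix_inv (fst k) *v fst z, matrix_inv (snd k) *v snd z)"

lemma K_act_eq: "K_act k f = (\<lambda>z. f (K_map k z))"
  by (auto simp: K_act_def K_map_def)

lemma orthogonal_matrix_inv:
  fixes a :: "real^'n::finite^'n"
  assumes "orthogonal_matrix a"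
  shows "orthogonal_transformation ((*v) (matrix_inv a))"
proof -
  have "a ** transpose a = mat 1" "transpose a ** a = mat 1"
    using assms by (simp_all add: orthogonal_matrix_def)
  moreover have "matrix_inv a ** a = mat 1"
    unfolding matrix_inv_def by (rule someI2[of _ "transpose a"]) (use calculation in auto)
  ultimately have "matrix_inv a = transpose a"
    by (metis matrix_mul_assoc matrix_mul_lid matrix_mul_rid)
  then show ?thesis
    using assms by (simp add: orthogonal_transformation_matrix orthogonal_matrix_transpose)
qed

lemma K_map_adapted:
  fixes k :: "(real^'p::finite^'p) \<times> (real^'q::finite^'q)"
  assumes "k \<in> Kgrp" "A = xbasis \<or> A = ybasis"
  shows "adapted_rotation (K_map k) A"
proof
  have a: "orthogonal_transformation ((*v) (matrix_inv (fst k)))"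
    and d: "orthogonal_transformation ((*v) (matrix_inv (snd k)))"
    using assms by (auto simp: Kgrp_def intro: orthogonal_matrix_inv)
  show "orthogonal_transformation (K_map k)"
    unfolding orthogonal_transformation_def
  proof (intro conjI allI)
    show "linear (K_map k)"
    proof (rule linearI)
      show "K_map k (v + w) = K_map k v + K_map k w" for v w
        by (simp add: K_map_def matrix_vector_right_distrib)
      show "K_map k (r *\<^sub>R v) = r *\<^sub>R K_map k v" for r v
        by (simp add: K_map_def matrix_vector_mult_scaleR)
    qed
    show "K_map k v \<bullet> K_map k w = v \<bullet> w" for v w
      using a d by (simp add: orthogonal_transformation_def K_map_def inner_prod_def)
  qed
  show "A \<subseteq> Basis" using assms(2) xbasis_subset ybasis_subset by blast
  show "K_map k b \<bullet> c = 0" if "b \<in> Basis" "c \<in> Basis" "(b \<in> A) \<noteq> (c \<in> A)" for b c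
  proof -
    have "b \<in> xbasis \<and> c \<in> ybasis \<or> b \<in> ybasis \<and> c \<in> xbasis"
      using that assms(2) Basis_xy by blast
    then show ?thesis
      by (auto simp: K_map_def xvec_def yvec_def inner_prod_def)
  qed
qed

lemma K_map_psi:
  assumes "k \<in> Kgrp"
  shows "psi \<alpha> (K_map k z) = psi \<alpha> z"
  by (simp add: psi_def rhox_eq rhoy_eq cscale_def
      adapted_rotation.rsq_invariant[OF K_map_adapted[OF assms]])

lemma K_act_closed:
  assumes "k \<in> Kgrp" "f \<in> Espace"
  shows "K_act k f \<in> Espace"
  unfolding K_act_eq using assms(2) unfolding Espace_eq
  by (rule polymod_compose_linear[rotated 2])
    (auto simp: K_map_psi[OF assms(1)] adapted_rotation.linear[OF K_map_adapted[OF assms(1) disjI1[OF refl]]])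

lemma K_act_commutes:
  assumes k: "k \<in> Kgrp" and f: "f \<in> Espace"
  shows "opXplus (K_act k f) = K_act k (opXplus f)"
    and "opXminus (K_act k f) = K_act k (opXminus f)"
    and "opH (K_act k f) = K_act k (opH f)"
  unfolding K_act_eq opXplus_eq opXminus_eq opH_eq
  by (simp_all add: Esp.Xop_compose[OF K_map_adapted[OF k] K_map_adapted[OF k] f]
      Esp.Eul_compose[OF K_map_adapted[OF k] f] fun_eq_iff fun_apply cscale_def)

lemma K_act_scale: "K_act k (cscale c f) = cscale c (K_act k f)"
  by (simp add: K_act_eq cscale_def)

section \<open>The isomorphism\<close>

lemma Mplus_eq: "Mplus m = sl2.highest m"
  unfolding Mplus_def by (rule sl2.highest_eq)

lemma Mminus_eq: "Mminus m = sl2_action.highest Espace opXminus opXplus (\<lambda>f. - opH f) m"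
proof -
  have "opH f = cscale (- of_nat m) f \<longleftrightarrow> - opH f = cscale (of_nat m) f" for f :: "('a, 'b) vfun"
    by (simp add: minus_equation_iff[of "opH f"] eq_commute)
  then show ?thesis
    unfolding Mminus_def by (simp only: sl2_action.highest_eq[OF sl2.swap])
qed

theorem proposition4p3:
  fixes m :: nat
  assumes "CARD('p::finite) mod 2 = CARD('q::finite) mod 2"
  shows "gK_isomorphic (Mplus m :: ('p, 'q) vfun set) (Mminus m :: ('p, 'q) vfun set)"
proof -
  interpret swap: sl2_action "Espace :: ('p, 'q) vfun set" opXminus opXplus "\<lambda>f. - opH f"
    by (rule sl2.swap)
  have in_V: "f \<in> Espace" if "f \<in> sl2.highest m" for f :: "('p, 'q) vfun"
    using that by (simp add: sl2.highest_def)
  have pi_plus: "pi_act X f \<in> sl2.highest m"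
    if "f \<in> sl2.highest m" for X and f :: "('p, 'q) vfun"
    using pi_act_closed pi_act_opXplus pi_act_opXminus pi_act_opH pi_act_scale that
    by (rule sl2.commuting_highest)
  have K_plus: "K_act k f \<in> sl2.highest m"
    if "f \<in> sl2.highest m" "k \<in> Kgrp" for k and f :: "('p, 'q) vfun"
    using K_act_closed[OF that(2)] K_act_commutes[OF that(2)] K_act_scale that(1)
    by (rule sl2.commuting_highest)
  have pi_neg: "- opH (pi_act X f) = pi_act X (- opH f)"
    if "f \<in> Espace" for X and f :: "('p, 'q) vfun"
    using pi_act_scale[OF sl2.H_closed[OF that], of X "- 1"] pi_act_opH[OF that] by simp
  have K_neg: "- opH (K_act k f) = K_act k (- opH f)"
    if "k \<in> Kgrp" "f \<in> Espace" for k and f :: "('p, 'q) vfun"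
    using K_act_scale[of k "- 1" "opH f"] K_act_commutes(3)[OF that] by simp
  have pi_minus: "pi_act X f \<in> swap.highest m"
    if "f \<in> swap.highest m" for X and f :: "('p, 'q) vfun"
    using pi_act_closed pi_act_opXminus pi_act_opXplus pi_neg pi_act_scale that
    by (rule swap.commuting_highest)
  have K_minus: "K_act k f \<in> swap.highest m"
    if "f \<in> swap.highest m" "k \<in> Kgrp" for k and f :: "('p, 'q) vfun"
    using K_act_closed[OF that(2)] K_act_commutes(2,1)[OF that(2)] K_neg[OF that(2)]
      K_act_scale that(1)
    by (rule swap.commuting_highest)
  have "gK_submodule (Mplus m :: ('p, 'q) vfun set)"
    unfolding gK_submodule_def Mplus_eq
    by (intro conjI ballI subsetI sl2.subspace_highest in_V pi_plus K_plus)
  moreover have "gK_submodule (Mminus m :: ('p, 'q) vfun set)"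
    unfolding gK_submodule_def Mminus_eq
    by (intro conjI ballI subsetI swap.subspace_highest pi_minus K_minus)
      (simp_all add: swap.highest_def)
  moreover have "gK_isomorphism (opXminus ^^ m) (Mplus m) (Mminus m :: ('p, 'q) vfun set)"
    unfolding gK_isomorphism_def Mplus_eq Mminus_eq
    by (simp add: sl2.bij_betw_Fpow sl2.Fpow_add sl2.Fpow_scale in_V
        sl2.commuting_Fpow pi_act_opXminus K_act_commutes)
  ultimately show ?thesis
    unfolding gK_isomorphic_def by blast
qed

end
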